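(* Let $k\in\mathbb{N}$, let $\gamma\subset\mathbb{R}^k$ be an analytic curve and let $a_1,\dots,a_k:\mathbb{N}\to\mathbb{R}$ be scattered sequences. Assume that either the sequences $a_1,\dots,a_k$ are jointly scattered or that the curve $\gamma$ is non-degenerate. Then for almost every $(x_1,\dots,x_k)\in\gamma$, the sequence $\big(a_1(n)x_1,\dots,a_k(n)x_k\big)_{n\in\mathbb{N}}$ is uniformly distributed in $\mathbb{T}^k$.
   Context: $\mathbb{N}=\{1,2,\dots\}$, $\mathbb{T}^k=\mathbb{R}^k/\mathbb{Z}^k$. A sequence $(x_n)_{n\in\mathbb{N}}$ in $\mathbb{R}^k$ is uniformly distributed in $\mathbb{T}^k$ (equivalently, uniformly distributed modulo 1) if for all intervals $I_1,\dots,I_k\subset[0,1]$, $\lim_{N\to\infty}\frac1N|\{n\in\{1,\dots,N\}:\{x_n\}\in I_1\times\cdots\times I_k\}|=\mu(I_1\times\cdots\times I_k)$, where $\mu$ is $k$-dimensional Lebesgue measure and $\{y\}$ is the vector of coordinatewise fractional parts of $y\in\mathbb{R}^k$. For $\delta\in(0,1]$, a sequence $a:\mathbb{N}\to\mathbb{R}$ is $\delta$-scattered if there exists $\epsilon>0$ such that for every sufficiently large $N$, $\frac1{N^2}\sum_{1\le m<n\le N}\min\big(|a(n)-a(m)|^{-\delta},1\big)\le\frac1{(\log N)^{1+\epsilon}}$ (with the term equal to $1$ when $a(n)=a(m)$). The sequence $a$ is scattered if it is $\delta$-scattered for every $\delta\in(0,1]$. Sequences $a_1,\dots,a_k:\mathbb{N}\to\mathbb{R}$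 are jointly scattered if for every non-zero $v=(v_1,\dots,v_k)\in\mathbb{R}^k$ the sequence $v_1a_1+\cdots+v_ka_k$ is scattered. An analytic curve in $\mathbb{R}^k$ is the image of a real analytic function $f:\mathbb{R}\to\mathbb{R}^k$. It is non-degenerate if it is not contained in a proper (affine) hyperplane of $\mathbb{R}^k$. "Almost every" point of $\gamma$ refers to one-dimensional Lebesgue (Hausdorff) measure on $\gamma$.
   Formalization: In the jointly scattered case the curve is also assumed not to lie in any hyperplane x_i = c; without this the claim fails, e.g. for a_1(n)=n, a_2(n)=n^2 and the line {0}×R. The non-degenerate case is unchanged. *)

theory Defs
  imports "HOL-Analysis.Analysis"
begin

text \<open>
  Sequences indexed by \<open>{1, 2, \<dots>}\<close> are functions on \<^typ>\<open>nat\<close> whose value at \<open>0\<close> is never used.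
  The number \<open>k\<close> of sequences is the cardinality of the finite index type \<open>'k\<close>.
\<close>

definition uniformly_distributed_mod1 :: "(nat \<Rightarrow> real ^ 'k) \<Rightarrow> bool" where
  "uniformly_distributed_mod1 x \<longleftrightarrow>
     (\<forall>I :: 'k \<Rightarrow> real set. (\<forall>i. is_interval (I i) \<and> I i \<subseteq> {0..1}) \<longrightarrow>
        (\<lambda>N. real (card {n \<in> {1..N}. \<forall>i. frac (x n $ i) \<in> I i}) / real N)
          \<longlonglongrightarrow> measure lborel {y :: real ^ 'k. \<forall>i. y $ i \<in> I i})"

text \<open>
  The explicit case distinction is needed because \<^term>\<open>0 powr (- \<delta>) = (0 :: real)\<close>,
  whereas the truncated kernel has to be \<open>1\<close> at \<open>0\<close>.
\<close>

definition delta_scattered :: "real \<Rightarrow> (nat \<Rightarrow> real) \<Rightarrow> bool" where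
  "delta_scattered \<delta> a \<longleftrightarrow>
     (\<exists>\<epsilon>>0. \<forall>\<^sub>F N in sequentially.
        1 / (real N)\<^sup>2 *
          (\<Sum>n\<in>{1..N}. \<Sum>m\<in>{1..<n}.
             (if a n = a m then 1 else min (\<bar>a n - a m\<bar> powr (- \<delta>)) 1))
        \<le> 1 / (ln (real N)) powr (1 + \<epsilon>))"

definition scattered :: "(nat \<Rightarrow> real) \<Rightarrow> bool" where
  "scattered a \<longleftrightarrow> (\<forall>\<delta>\<in>{0<..1}. delta_scattered \<delta> a)"

definition jointly_scattered :: "('k::finite \<Rightarrow> nat \<Rightarrow> real) \<Rightarrow> bool" where
  "jointly_scattered a \<longleftrightarrow>
     (\<forall>v :: real ^ 'k. v \<noteq> 0 \<longrightarrow> scattered (\<lambda>n. \<Sum>i\<in>UNIV. v $ i * a i n))"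

definition real_analytic :: "(real \<Rightarrow> 'b::real_normed_vector) \<Rightarrow> bool" where
  "real_analytic f \<longleftrightarrow>
     (\<forall>t\<^sub>0. \<exists>r>0. \<exists>c :: nat \<Rightarrow> 'b. \<forall>t. \<bar>t - t\<^sub>0\<bar> < r \<longrightarrow> (\<lambda>n. (t - t\<^sub>0) ^ n *\<^sub>R c n) sums f t)"

definition analytic_curve :: "(real ^ 'k) set \<Rightarrow> bool" where
  "analytic_curve \<gamma> \<longleftrightarrow> (\<exists>f :: real \<Rightarrow> real ^ 'k. real_analytic f \<and> \<gamma> = range f)"

definition nondegenerate :: "(real ^ 'k) set \<Rightarrow> bool" where
  "nondegenerate \<gamma> \<longleftrightarrow> \<not> (\<exists>v c. v \<noteq> 0 \<and> \<gamma> \<subseteq> {x. v \<bullet> x = c})"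

text \<open>
  Without this condition the theorem fails for jointly scattered sequences: \<open>a\<^sub>1(n) = n\<close> and
  \<open>a\<^sub>2(n) = n\<^sup>2\<close> are jointly scattered, but on the line \<open>{0} \<times> \<real>\<close> the first coordinate
  of \<open>(a\<^sub>1(n) x\<^sub>1, a\<^sub>2(n) x\<^sub>2)\<close> is constantly \<open>0\<close>. Every non-degenerate curve satisfies it.
\<close>

definition no_constant_coordinate :: "(real ^ 'k) set \<Rightarrow> bool" where
  "no_constant_coordinate \<gamma> \<longleftrightarrow> (\<forall>i c. \<not> \<gamma> \<subseteq> {x. x $ i = c})"

text \<open>
  One-dimensional Hausdorff (outer) measure. The sets of a cover are required to be bounded because
  \<^const>\<open>diameter\<close> has no meaningful value on unbounded sets.
\<close>

definition hausdorff1_pre :: "real \<Rightarrow> 'b::metric_space set \<Rightarrow> ennreal" where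
  "hausdorff1_pre \<eta> A =
     Inf {\<Sum>n. ennreal (diameter (U n)) | U :: nat \<Rightarrow> 'b set.
            A \<subseteq> (\<Union>n. U n) \<and> (\<forall>n. bounded (U n) \<and> diameter (U n) \<le> \<eta>)}"

definition hausdorff1 :: "'b::metric_space set \<Rightarrow> ennreal" where
  "hausdorff1 A = (SUP \<eta>\<in>{0<..}. hausdorff1_pre \<eta> A)"

definition almost_every_on_curve :: "(real ^ 'k) set \<Rightarrow> (real ^ 'k \<Rightarrow> bool) \<Rightarrow> bool" where
  "almost_every_on_curve \<gamma> P \<longleftrightarrow> hausdorff1 {x \<in> \<gamma>. \<not> P x} = 0"

end

(*
  Fix a non-zero integer frequency h and put w(n) = (h_1 a_1(n), ..., h_k a_k(n)). The square of the
  Weyl sum of cis (2 pi w(n) . f(t)), integrated over a short interval of t, is a double sum of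
  oscillatory integrals with phases (w(n) - w(m)) . f. Some derivative of u . f is non-zero at a
  given point whenever u . f is not constant; by compactness and van der Corput's lemma each
  integral is at most a constant times |P(w(n) - w(m))|^(-delta), where P is the orthogonal
  projection away from the directions along which f is constant and delta > 0 depends only on the
  point. The scalar product of w with a suitable unit vector in the range of P is scattered, so the
  mean square is O(1 / (log N)^(1 + epsilon)), and a Borel-Cantelli argument along a subsequence of
  ratio tending to 1 gives pointwise convergence to 0. Weyl's criterion then applies outside a null
  set of parameters, which the locally Lipschitz map f sends to a Hausdorff null set.
*)
theory Submission
  imports Defs "HOL-Real_Asymp.Real_Asymp"
begin

section \<open>Oscillatory integrals\<close>

text \<open>Two obstacles shape the proof. The differences w(n) - w(m) are unbounded and may have a
  large component along which f is constant, where nothing oscillates; so decay is measured against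
  one fixed linear functional of w, whose absolute value never exceeds the length of the oscillating
  component. And the exponent delta degenerates from point to point, because the order of the
  derivative in use is controlled only near a given parameter; this is why scatteredness is demanded
  for every delta, and why negligibility of the exceptional parameters is checked locally.

  The logarithmic saving is just enough: a subsequence sparse enough to make 1 / (log N)^(1 +
  epsilon) summable can still have consecutive ratios tending to 1. In Weyl's criterion only upper
  bounds for box frequencies are proved; the other boxes of a partition of the cube turn them into
  lower bounds.\<close>

text \<open>Integration by parts against \<open>1 / (\<Lambda> * G 1 t)\<close>. The classical
  estimate asks for a monotone first derivative; here a bound \<open>M\<close> on the second
  derivative controls the remainder instead. \<open>G j\<close> runs through the successive
  derivatives of the phase \<open>G 0\<close>, the format in which the induction on the order
  works.\<close>

lemma van_der_Corput_first:
  fixes G :: "nat \<Rightarrow> real \<Rightarrow> real"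
  assumes D: "\<And>j t. (G j has_real_derivative G (Suc j) t) (at t)"
    and "p \<le> q" "0 < \<eta>" "\<eta> \<le> 1" "0 < \<Lambda>"
    and low: "\<And>t. t \<in> {p..q} \<Longrightarrow> \<eta> \<le> \<bar>G 1 t\<bar>"
    and M: "\<And>t. t \<in> {p..q} \<Longrightarrow> \<bar>G 2 t\<bar> \<le> M"
  shows "norm (integral {p..q} (\<lambda>t. cis (\<Lambda> * G 0 t))) \<le> (2 + M * (q - p)) / \<eta>\<^sup>2 / \<Lambda>"
proof -
  have contG: "continuous_on A (G j)" for A j
    using D by (meson DERIV_isCont continuous_at_imp_continuous_on)
  have nz: "G 1 t \<noteq> 0" if "t \<in> {p..q}" for t using low[OF that] \<open>0 < \<eta>\<close> by auto
  define F where "F t = cis (\<Lambda> * G 0 t) * of_real (1 / (\<Lambda> * G 1 t))" for t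
  define R where "R t = cis (\<Lambda> * G 0 t) * of_real (G 2 t / (\<Lambda> * (G 1 t)\<^sup>2))" for t
  have "(F has_vector_derivative (\<i> * cis (\<Lambda> * G 0 t) - R t)) (at t within {p..q})" if t: "t \<in> {p..q}" for t
  proof -
    have 1: "((\<lambda>t. cis (\<Lambda> * G 0 t)) has_vector_derivative (\<Lambda> * G 1 t) *\<^sub>R (\<i> * cis (\<Lambda> * G 0 t))) (at t within {p..q})"
    proof -
      have a: "((\<lambda>t. \<Lambda> * G 0 t) has_vector_derivative \<Lambda> * G 1 t) (at t within {p..q})"
        using DERIV_cmult[OF D[of 0 t], of \<Lambda>]
        by (simp add: has_real_derivative_iff_has_vector_derivative has_vector_derivative_at_within)
      have b: "(cis has_vector_derivative \<i> * cis (\<Lambda> * G 0 t)) (at (\<Lambda> * G 0 t) within (\<lambda>t. \<Lambda> * G 0 t) ` {p..q})"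
        by (auto intro!: derivative_eq_intros simp: has_vector_derivative_def scaleR_conv_of_real)
      show ?thesis using vector_diff_chain_within[OF a b] by (simp add: o_def)
    qed
    have 2: "((\<lambda>t. of_real (1 / (\<Lambda> * G 1 t)) :: complex) has_vector_derivative of_real (- G 2 t / (\<Lambda> * (G 1 t)\<^sup>2))) (at t within {p..q})"
    proof -
      have "((\<lambda>t. 1 / (\<Lambda> * G 1 t)) has_real_derivative (- G 2 t / (\<Lambda> * (G 1 t)\<^sup>2))) (at t)"
        using D[of 1 t] nz[OF t] \<open>0 < \<Lambda>\<close>
        by (auto intro!: derivative_eq_intros simp: numeral_2_eq_2 power2_eq_square field_simps)
      then show ?thesis
        by (intro has_vector_derivative_of_real has_vector_derivative_at_within)
           (simp add: has_real_derivative_iff_has_vector_derivative)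
    qed
    show ?thesis unfolding F_def R_def
      using has_vector_derivative_mult[OF 1 2] nz[OF t] \<open>0 < \<Lambda>\<close>
      by (simp add: scaleR_conv_of_real field_simps)
  qed
  then have "((\<lambda>t. \<i> * cis (\<Lambda> * G 0 t) - R t) has_integral F q - F p) {p..q}"
    by (rule fundamental_theorem_of_calculus[OF \<open>p \<le> q\<close>])
  moreover have Rcont: "continuous_on {p..q} R"
    unfolding R_def using nz \<open>0 < \<Lambda>\<close> by (intro continuous_intros contG) auto
  then have Rint: "R integrable_on {p..q}" by (rule integrable_continuous_interval)
  ultimately have "((\<lambda>t. \<i> * cis (\<Lambda> * G 0 t)) has_integral F q - F p + integral {p..q} R) {p..q}"
    using has_integral_add[of "\<lambda>t. \<i> * cis (\<Lambda> * G 0 t) - R t" _ _ R] by (fastforce simp: integrable_integral)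
  then have "integral {p..q} (\<lambda>t. \<i> * cis (\<Lambda> * G 0 t)) = F q - F p + integral {p..q} R"
    by blast
  then have eq: "\<i> * integral {p..q} (\<lambda>t. cis (\<Lambda> * G 0 t)) = F q - F p + integral {p..q} R"
    by (simp add: integral_mult_right)
  have nF: "norm (F t) \<le> 1 / (\<Lambda> * \<eta>)" if "t \<in> {p..q}" for t
    using low[OF that] nz[OF that] \<open>0 < \<Lambda>\<close> \<open>0 < \<eta>\<close>
    by (simp add: F_def norm_mult norm_divide abs_mult frac_le)
  have nR: "norm (R t) \<le> M / (\<Lambda> * \<eta>\<^sup>2)" if "t \<in> {p..q}" for t
  proof -
    have "\<eta>\<^sup>2 \<le> (G 1 t)\<^sup>2" using low[OF that] \<open>0 < \<eta>\<close> by (simp add: abs_le_square_iff[symmetric])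
    then show ?thesis
      using M[OF that] nz[OF that] \<open>0 < \<Lambda>\<close> \<open>0 < \<eta>\<close>
      unfolding R_def by (simp add: norm_mult norm_divide abs_mult norm_power del: of_real_power)
        (intro frac_le, auto)
  qed
  have "norm (integral {p..q} R) \<le> M / (\<Lambda> * \<eta>\<^sup>2) * (q - p)"
    using nR \<open>p \<le> q\<close> Rcont by (intro integral_bound) auto
  then have "norm (\<i> * integral {p..q} (\<lambda>t. cis (\<Lambda> * G 0 t))) \<le> 1 / (\<Lambda> * \<eta>) + 1 / (\<Lambda> * \<eta>) + M / (\<Lambda> * \<eta>\<^sup>2) * (q - p)"
    unfolding eq using nF[of p] nF[of q] \<open>p \<le> q\<close>
    by (intro order_trans[OF norm_triangle_ineq] add_mono order_trans[OF norm_triangle_ineq4]) auto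
  \<comment> \<open>\<open>\<eta> \<le> 1\<close> puts boundary terms and remainder over the common
    denominator \<open>\<eta>\<^sup>2\<close>.\<close>
  also have "1 / (\<Lambda> * \<eta>) \<le> 1 / (\<Lambda> * \<eta>\<^sup>2)"
    using \<open>0 < \<Lambda>\<close> \<open>0 < \<eta>\<close> \<open>\<eta> \<le> 1\<close> by (intro frac_le mult_left_mono) (auto simp: power2_eq_square mult_left_le)
  finally show ?thesis using \<open>0 < \<Lambda>\<close> \<open>0 < \<eta>\<close> by (simp add: norm_mult field_simps)
qed

text \<open>The exponent is far from optimal; any power of \<open>\<Lambda>\<close> suffices for scattered sequences.\<close>

lemma van_der_Corput:
  fixes G :: "nat \<Rightarrow> real \<Rightarrow> real"
  assumes D: "\<And>j t. (G j has_real_derivative G (Suc j) t) (at t)"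
    and M: "\<And>t. t \<in> {a..b} \<Longrightarrow> \<bar>G 2 t\<bar> \<le> M" and "0 \<le> M" "1 \<le> \<Lambda>"
  shows "a \<le> p \<Longrightarrow> p \<le> q \<Longrightarrow> q \<le> b \<Longrightarrow> 0 < \<eta> \<Longrightarrow> \<eta> \<le> 1 \<Longrightarrow>
    (\<And>t. t \<in> {p<..<q} \<Longrightarrow> \<eta> \<le> \<bar>G (Suc d) t\<bar>) \<Longrightarrow>
    norm (integral {p..q} (\<lambda>t. cis (\<Lambda> * G 0 t)))
      \<le> 4 ^ d * (2 + M * (b - a)) / \<eta>\<^sup>2 * \<Lambda> powr (- ((1/3) ^ d))"
proof (induction d arbitrary: p q \<eta>)
  case 0
  have contG: "continuous_on A (G j)" for A j
    using D by (meson DERIV_isCont continuous_at_imp_continuous_on)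
  show ?case
  proof (cases "p = q")
    case True
    then show ?thesis using 0 \<open>0 \<le> M\<close> \<open>1 \<le> \<Lambda>\<close> by simp
  next
    case False
    \<comment> \<open>The lower bound is assumed on the open interval because the inductive step
      applies it on intervals ending at an infimum or supremum, where it is known only for points
      strictly beyond that end. Continuity restores the end points.\<close>
    then have "closure {p<..<q} = {p..q}" using 0 by simp
    then have "\<eta> \<le> \<bar>G 1 t\<bar>" if "t \<in> {p..q}" for t
      using continuous_ge_on_closure[of "{p<..<q}" "\<lambda>t. \<bar>G 1 t\<bar>" t \<eta>] 0 that
      by (auto intro!: continuous_intros contG)
    then have "norm (integral {p..q} (\<lambda>t. cis (\<Lambda> * G 0 t))) \<le> (2 + M * (q - p)) / \<eta>\<^sup>2 / \<Lambda>"
      using 0 M \<open>1 \<le> \<Lambda>\<close> by (intro van_der_Corput_first D) auto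
    also have "\<dots> \<le> (2 + M * (b - a)) / \<eta>\<^sup>2 / \<Lambda>"
      using 0 \<open>1 \<le> \<Lambda>\<close> \<open>0 \<le> M\<close> by (intro divide_right_mono add_left_mono mult_left_mono) auto
    finally show ?thesis using \<open>1 \<le> \<Lambda>\<close> by (simp add: powr_minus_divide)
  qed
next
  case (Suc d)
  have contG: "continuous_on A (G j)" for A j
    using D by (meson DERIV_isCont continuous_at_imp_continuous_on)
  define I where "I p q = integral {p..q} (\<lambda>t. cis (\<Lambda> * G 0 t))" for p q
  have int: "(\<lambda>t. cis (\<Lambda> * G 0 t)) integrable_on {p..q}" for p q
    by (intro integrable_continuous_interval continuous_intros contG)
  have triv: "norm (I p q) \<le> q - p" if "p \<le> q" for p q
  proof -
    have "continuous_on {p..q} (\<lambda>t. cis (\<Lambda> * G 0 t))" by (intro continuous_intros contG)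
    then show ?thesis unfolding I_def using integral_bound[OF that, of "\<lambda>t. cis (\<Lambda> * G 0 t)" 1] by simp
  qed
  define r where "r = (1/3::real) ^ d"
  have "0 < r" by (simp add: r_def)
  \<comment> \<open>Threshold splitting the interval: where the derivative of order
    \<open>Suc d\<close> is at least \<open>\<theta>\<close>, the induction hypothesis costs
    \<open>K / \<theta>\<^sup>2 * \<Lambda> powr (- r)\<close>; elsewhere only the length, of order
    \<open>\<theta>\<close>, is used. This choice turns the former into \<open>K * \<theta>\<close>,
    whence the factor 1/3 in the exponent.\<close>
  define \<theta> where "\<theta> = \<Lambda> powr (- r / 3)"
  define K where "K = 4 ^ d * (2 + M * (b - a))"
  have "0 \<le> M * (b - a)" using Suc.prems \<open>0 \<le> M\<close> by simp
  then have "1 \<le> K" unfolding K_def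
    using mult_mono[of 1 "4^d" 1 "2 + M * (b - a)"] by simp
  have th: "0 < \<theta>" "\<theta> \<le> 1" using \<open>1 \<le> \<Lambda>\<close> \<open>0 < r\<close> unfolding \<theta>_def
    by (auto intro!: powr_le1 simp: powr_minus_divide ge_one_powr_ge_zero)
  have th2: "\<theta>\<^sup>2 = \<Lambda> powr (- (2 * r / 3))" unfolding \<theta>_def using \<open>1 \<le> \<Lambda>\<close>
    by (simp add: power2_eq_square powr_add[symmetric])
  have IH: "norm (I p' q') \<le> K * \<theta>" if "p \<le> p'" "p' \<le> q'" "q' \<le> q"
    "\<And>t. t \<in> {p'<..<q'} \<Longrightarrow> \<theta> \<le> \<bar>G (Suc d) t\<bar>" for p' q'
  proof -
    have "norm (I p' q') \<le> K / \<theta>\<^sup>2 * \<Lambda> powr (- r)"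
      using Suc.IH[of p' q' \<theta>] that Suc.prems th unfolding I_def K_def r_def by simp
    also have "\<dots> = K * (\<Lambda> powr (- r) / \<Lambda> powr (- (2 * r / 3)))" unfolding th2 by simp
    also have "\<Lambda> powr (- r) / \<Lambda> powr (- (2 * r / 3)) = \<theta>" unfolding \<theta>_def powr_diff[symmetric]
      by (simp add: field_simps)
    finally show ?thesis .
  qed
  have main: "norm (I p q) \<le> 2 * \<theta> / \<eta> + 2 * (K * \<theta>)"
  proof (cases "\<exists>t\<in>{p..q}. \<bar>G (Suc d) t\<bar> < \<theta>")
    case False
    then have "norm (I p q) \<le> K * \<theta>" using Suc.prems by (intro IH) (auto simp: not_less)
    moreover have "0 \<le> \<theta> / \<eta>" "0 \<le> K * \<theta>" using th \<open>1 \<le> K\<close> Suc.prems by auto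
    ultimately show ?thesis by linarith
  next
    case True
    define E where "E = {t\<in>{p..q}. \<bar>G (Suc d) t\<bar> < \<theta>}"
    have E: "E \<noteq> {}" "bdd_below E" "bdd_above E" "E \<subseteq> {p..q}" using True unfolding E_def by auto
    define s1 s2 where "s1 = Inf E" and "s2 = Sup E"
    have s: "p \<le> s1" "s1 \<le> s2" "s2 \<le> q" unfolding s1_def s2_def using E
      by (auto intro!: cInf_greatest cSup_least cInf_le_cSup)
    \<comment> \<open>\<open>E\<close> need not be an interval, but the mean value theorem and the
      lower bound for the next derivative make its diameter small, so a single interval from
      \<open>s1\<close> to \<open>s2\<close> is cut out and two remain.\<close>
    have diam: "t - s \<le> 2 * \<theta> / \<eta>" if "s \<in> E" "t \<in> E" for s t
    proof (cases "s < t")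
      case True
      obtain z where z: "s < z" "z < t" "G (Suc d) t - G (Suc d) s = (t - s) * G (Suc (Suc d)) z"
        using MVT2[OF True, of "G (Suc d)" "G (Suc (Suc d))"] D by blast
      have "\<eta> \<le> \<bar>G (Suc (Suc d)) z\<bar>" using Suc.prems(6)[of z] z that E by force
      then have "(t - s) * \<eta> \<le> \<bar>G (Suc d) t - G (Suc d) s\<bar>"
        unfolding z abs_mult using True Suc.prems(4) by (intro mult_mono) auto
      also have "\<dots> \<le> 2 * \<theta>" using that unfolding E_def by auto
      finally show ?thesis using \<open>0 < \<eta>\<close> by (simp add: field_simps)
    next
      case False
      moreover have "0 \<le> 2 * \<theta> / \<eta>" using th Suc.prems by simp
      ultimately show ?thesis by linarith
    qed
    have "s2 \<le> s + 2 * \<theta> / \<eta>" if "s \<in> E" for s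
      unfolding s2_def using diam[OF that] E by (intro cSup_least) (auto simp: algebra_simps)
    then have "s2 - 2 * \<theta> / \<eta> \<le> s1"
      unfolding s1_def using E by (intro cInf_greatest) (auto simp: algebra_simps)
    then have mid: "norm (I s1 s2) \<le> 2 * \<theta> / \<eta>" using triv[OF s(2)] by linarith
    have out: "\<theta> \<le> \<bar>G (Suc d) t\<bar>" if "t \<in> {p..q}" "t < s1 \<or> s2 < t" for t
    proof (rule ccontr)
      assume "\<not> ?thesis"
      then have "t \<in> E" using that unfolding E_def by auto
      then have "s1 \<le> t" "t \<le> s2" unfolding s1_def s2_def using E by (auto intro: cInf_lower cSup_upper)
      then show False using that by auto
    qed
    have "norm (I p s1) \<le> K * \<theta>" "norm (I s2 q) \<le> K * \<theta>"
      using s by (auto intro!: IH out)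
    moreover have "I p q = I p s1 + I s1 s2 + I s2 q"
      unfolding I_def using s int
      by (metis (no_types, lifting) Henstock_Kurzweil_Integration.integral_combine order_trans)
    ultimately show ?thesis using mid norm_triangle_ineq[of "I p s1 + I s1 s2" "I s2 q"] norm_triangle_ineq[of "I p s1" "I s1 s2"]
      by simp
  qed
  \<comment> \<open>Since \<open>1 \<le> K\<close> and \<open>\<eta> \<le> 1\<close>, the cut
    contributes at most twice \<open>K * \<theta> / \<eta>\<^sup>2\<close> and so do the two outer
    intervals together: the factor 4 gained at each order.\<close>
  have e1: "1 / \<eta> \<le> 1 / \<eta>\<^sup>2" using Suc.prems by (intro frac_le) (auto simp: power2_eq_square mult_left_le)
  have e2: "1 \<le> 1 / \<eta>\<^sup>2" using Suc.prems by (simp add: power_le_one)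
  have "2 * \<theta> / \<eta> + 2 * (K * \<theta>) = \<theta> * (2 * (1/\<eta>) + 2 * K * 1)" by (simp add: algebra_simps)
  also have "\<dots> \<le> \<theta> * (2 * K * (1 / \<eta>\<^sup>2) + 2 * K * (1 / \<eta>\<^sup>2))"
    using e1 e2 \<open>1 \<le> K\<close> th Suc.prems by (intro mult_left_mono add_mono mult_mono) auto
  also have "\<dots> = 4 * K / \<eta>\<^sup>2 * \<theta>" by simp
  finally have "norm (I p q) \<le> 4 * K / \<eta>\<^sup>2 * \<theta>" using main by linarith
  then show ?case unfolding I_def K_def \<theta>_def r_def by (simp add: mult.assoc)
qed

section \<open>Real analytic functions\<close>

text \<open>Both facts speak of \<open>deriv g\<close>, so that they iterate: the second has the
  shape of the hypothesis, with \<open>c\<close> replaced by \<open>diffs c\<close> and the same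
  radius.\<close>

lemma powser_deriv:
  fixes g :: "real \<Rightarrow> real"
  assumes g: "\<And>s. \<bar>s - t\<^sub>0\<bar> < r \<Longrightarrow> (\<lambda>n. c n * (s - t\<^sub>0) ^ n) sums g s"
    and s: "\<bar>s - t\<^sub>0\<bar> < r"
  shows "(g has_real_derivative deriv g s) (at s)"
    and "(\<lambda>n. diffs c n * (s - t\<^sub>0) ^ n) sums deriv g s"
proof -
  define h where "h z = (\<Sum>n. c n * z ^ n)" for z
  have sums: "(\<lambda>n. c n * z ^ n) sums h z" if "norm z < r" for z
    using g[of "z + t\<^sub>0"] that unfolding h_def by (auto simp: sums_iff)
  have h: "(h has_real_derivative (\<Sum>n. diffs c n * z ^ n)) (at z)" if "norm z < r" for z
    unfolding h_def using that sums by (intro termdiffs_strong') (auto simp: sums_iff)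
  have "((\<lambda>s. h (s - t\<^sub>0)) has_real_derivative (\<Sum>n. diffs c n * (s - t\<^sub>0) ^ n)) (at s)"
    using DERIV_shift[of h _ s "- t\<^sub>0"] h[of "s - t\<^sub>0"] s by simp
  moreover have "eventually (\<lambda>s. h (s - t\<^sub>0) = g s) (nhds s)"
  proof -
    have "eventually (\<lambda>s. s \<in> ball t\<^sub>0 r) (nhds s)"
      using s by (intro eventually_nhds_in_open) (auto simp: dist_real_def abs_minus_commute)
    then show ?thesis
    proof eventually_elim
      case (elim s)
      then have "\<bar>s - t\<^sub>0\<bar> < r" by (simp add: dist_real_def abs_minus_commute)
      from sums_unique[OF g[OF this]] show ?case unfolding h_def by (rule sym)
    qed
  qed
  ultimately have d: "(g has_real_derivative (\<Sum>n. diffs c n * (s - t\<^sub>0) ^ n)) (at s)"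
    by (simp add: DERIV_cong_ev[OF refl _ refl])
  then show "(g has_real_derivative deriv g s) (at s)" by (simp add: DERIV_imp_deriv)
  have "summable (\<lambda>n. diffs c n * (s - t\<^sub>0) ^ n)"
    using termdiff_converges[of "s - t\<^sub>0" r c] sums s by (auto simp: sums_iff)
  then show "(\<lambda>n. diffs c n * (s - t\<^sub>0) ^ n) sums deriv g s"
    using DERIV_imp_deriv[OF d] by (simp add: sums_iff)
qed

lemma powser_higher_deriv:
  fixes g :: "real \<Rightarrow> real"
  assumes "\<And>s. \<bar>s - t\<^sub>0\<bar> < r \<Longrightarrow> (\<lambda>n. c n * (s - t\<^sub>0) ^ n) sums g s" and "\<bar>s - t\<^sub>0\<bar> < r"
  shows "((deriv ^^ j) g has_real_derivative (deriv ^^ Suc j) g s) (at s)"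
    and "(\<lambda>n. (diffs ^^ j) c n * (s - t\<^sub>0) ^ n) sums (deriv ^^ j) g s"
proof -
  have *: "(\<lambda>n. (diffs ^^ j) c n * (s - t\<^sub>0) ^ n) sums (deriv ^^ j) g s" if "\<bar>s - t\<^sub>0\<bar> < r" for s
    using that
  proof (induction j arbitrary: s)
    case (Suc j)
    show ?case using powser_deriv(2)[OF Suc.IH Suc.prems] by simp
  qed (use assms in auto)
  show "(\<lambda>n. (diffs ^^ j) c n * (s - t\<^sub>0) ^ n) sums (deriv ^^ j) g s" using * assms(2) by blast
  show "((deriv ^^ j) g has_real_derivative (deriv ^^ Suc j) g s) (at s)"
    using powser_deriv(1)[OF * assms(2)] by simp
qed

text \<open>Taylor's formula for the coefficients: the series of the \<open>n\<close>-th derivative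
  evaluated at its centre is this term, so vanishing derivatives force vanishing
  coefficients.\<close>

lemma diffs_funpow_0: "(diffs ^^ n) c 0 = (fact n * c n :: real)"
  by (induction n arbitrary: c) (simp_all add: funpow_Suc_right diffs_def algebra_simps del: funpow.simps(2))

lemma real_analytic_powser:
  fixes g :: "real \<Rightarrow> real"
  assumes "real_analytic g"
  obtains r c where "r > 0" "\<And>s. \<bar>s - t\<^sub>0\<bar> < r \<Longrightarrow> (\<lambda>n. c n * (s - t\<^sub>0) ^ n) sums g s"
  using assms unfolding real_analytic_def by (simp add: mult.commute) meson

lemma real_analytic_higher_deriv:
  fixes g :: "real \<Rightarrow> real"
  assumes "real_analytic g"
  shows "((deriv ^^ j) g has_real_derivative (deriv ^^ Suc j) g t) (at t)"
proof -
  obtain r c where "r > 0" "\<And>s. \<bar>s - t\<bar> < r \<Longrightarrow> (\<lambda>n. c n * (s - t) ^ n) sums g s"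
    using real_analytic_powser[OF assms] by metis
  then show ?thesis using powser_higher_deriv(1)[of t r c g t j] by simp
qed

text \<open>Identity theorem by connectedness: the points where all derivatives of positive order
  vanish form a closed set by continuity, and an open one because at such a point the power series
  reduces to its constant term.\<close>

lemma real_analytic_constant:
  fixes g :: "real \<Rightarrow> real"
  assumes "real_analytic g" and "\<And>d. (deriv ^^ Suc d) g t\<^sub>0 = 0"
  shows "g t = g t\<^sub>0"
proof -
  define Z where "Z = {t. \<forall>d. (deriv ^^ Suc d) g t = 0}"
  have "closed Z"
  proof -
    have "isCont ((deriv ^^ Suc d) g) t" for d t
      using DERIV_isCont[OF real_analytic_higher_deriv[OF assms(1)]] .
    then have "closed {t. (deriv ^^ Suc d) g t = 0}" for d
      by (intro closed_Collect_eq continuous_on_const continuous_at_imp_continuous_on) auto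
    moreover have "Z = (\<Inter>d. {t. (deriv ^^ Suc d) g t = 0})" unfolding Z_def by auto
    ultimately show ?thesis by auto
  qed
  moreover have "open Z"
  proof (subst open_dist, intro ballI)
    fix t assume t: "t \<in> Z"
    obtain r c where r: "r > 0" and c: "\<And>s. \<bar>s - t\<bar> < r \<Longrightarrow> (\<lambda>n. c n * (s - t) ^ n) sums g s"
      using real_analytic_powser[OF assms(1)] by metis
    have "c (Suc n) = 0" for n
    proof -
      have "(deriv ^^ Suc n) g t = 0" using t unfolding Z_def by blast
      then have "(\<lambda>m. (diffs ^^ Suc n) c m * 0 ^ m) sums 0"
        using powser_higher_deriv(2)[OF c, where s = t and j = "Suc n"] r by (simp del: funpow.simps)
      then have "(diffs ^^ Suc n) c 0 = 0"
        using powser_sums_zero[of "(diffs ^^ Suc n) c"] sums_unique2 by blast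
      then show ?thesis unfolding diffs_funpow_0 by simp
    qed
    then have "(diffs ^^ d) c (Suc n) = 0" for d n
      by (induction d arbitrary: n) (auto simp: diffs_def)
    then have "diffs ((diffs ^^ d) c) = (\<lambda>_. 0)" for d by (auto simp: diffs_def)
    then have "(deriv ^^ Suc d) g s = 0" if "\<bar>s - t\<bar> < r" for d s
      using powser_higher_deriv(2)[OF c that, of "Suc d"] by (simp add: sums_iff)
    then show "\<exists>e>0. \<forall>y. dist y t < e \<longrightarrow> y \<in> Z"
      using r unfolding Z_def by (auto simp: dist_real_def)
  qed
  ultimately have "Z = {} \<or> Z = UNIV" using clopen by blast
  then have "Z = UNIV" using assms(2) unfolding Z_def by auto
  then have "(g has_real_derivative 0) (at t)" for t
    using real_analytic_higher_deriv[OF assms(1), of 0 t] unfolding Z_def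
    by (metis (mono_tags, lifting) UNIV_I funpow_0 mem_Collect_eq)
  then show ?thesis using DERIV_isconst_all by blast
qed

lemma real_analytic_bounded_linear:
  assumes "real_analytic f" "bounded_linear T"
  shows "real_analytic (\<lambda>t. T (f t))"
  unfolding real_analytic_def
proof
  interpret bounded_linear T by fact
  fix t\<^sub>0
  obtain r c where "r > 0" "\<And>t. \<bar>t - t\<^sub>0\<bar> < r \<Longrightarrow> (\<lambda>n. (t - t\<^sub>0) ^ n *\<^sub>R c n) sums f t"
    using assms(1) unfolding real_analytic_def by meson
  then show "\<exists>r>0. \<exists>c. \<forall>t. \<bar>t - t\<^sub>0\<bar> < r \<longrightarrow> (\<lambda>n. (t - t\<^sub>0) ^ n *\<^sub>R c n) sums T (f t)"
    using sums by (intro exI[of _ r] conjI exI[of _ "\<lambda>n. T (c n)"]) (auto simp: scaleR[symmetric])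
qed

lemma real_analytic_continuous_on:
  fixes f :: "real \<Rightarrow> real ^ 'k"
  assumes "real_analytic f"
  shows "continuous_on A f"
proof -
  have "continuous_on A (\<lambda>t. f t $ i)" for i
    using real_analytic_higher_deriv[OF real_analytic_bounded_linear[OF assms bounded_linear_vec_nth], of 0]
    by (auto intro!: continuous_at_imp_continuous_on DERIV_isCont)
  then have "continuous_on A (\<lambda>t. \<chi> i. f t $ i)" by (rule continuous_on_vec_lambda)
  then show ?thesis by simp
qed

section \<open>Decay near a point, uniformly over a compact set of directions\<close>

text \<open>Each pair of indices will bring its own direction \<open>u\<close>, so the interval,
  \<open>K\<close> and \<open>\<delta>\<close> must not depend on \<open>u\<close>. The order of a
  non-vanishing derivative does depend on it; a finite subcover bounds that order by
  \<open>Suc N\<close>, and \<open>\<delta>\<close> is \<open>(1/3) ^ N\<close>.\<close>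

lemma local_oscillatory_bound:
  fixes f :: "real \<Rightarrow> real ^ 'k" and S :: "(real ^ 'k) set"
  assumes f: "real_analytic f" and S: "compact S"
    and nonconst: "\<And>u. u \<in> S \<Longrightarrow> \<exists>t. u \<bullet> f t \<noteq> u \<bullet> f t\<^sub>0"
  obtains p q K \<delta> where "p < t\<^sub>0" "t\<^sub>0 < q" "0 < \<delta>" "\<delta> \<le> 1" "0 \<le> K"
    "\<And>u \<Lambda>. u \<in> S \<Longrightarrow> 1 \<le> \<Lambda> \<Longrightarrow> norm (integral {p..q} (\<lambda>t. cis (\<Lambda> * (u \<bullet> f t)))) \<le> K * \<Lambda> powr (- \<delta>)"
proof -
  \<comment> \<open>\<open>deriv\<close> acts on scalar functions, so the derivatives of the curve
    are assembled coordinatewise.\<close>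
  define F :: "nat \<Rightarrow> real \<Rightarrow> real ^ 'k" where "F j t = (\<chi> i. (deriv ^^ j) (\<lambda>t. f t $ i) t)" for j t
  have fi: "real_analytic (\<lambda>t. f t $ i)" for i
    using real_analytic_bounded_linear[OF f bounded_linear_vec_nth] .
  have DF: "((\<lambda>t. F j t $ i) has_real_derivative F (Suc j) t $ i) (at t)" for j t i
    unfolding F_def using real_analytic_higher_deriv[OF fi] by simp
  have D: "((\<lambda>t. u \<bullet> F j t) has_real_derivative u \<bullet> F (Suc j) t) (at t)" for u j t
    unfolding inner_vec_def inner_real_def by (intro DERIV_sum DERIV_cmult DF)
  have F0: "F 0 t = f t" for t by (simp add: F_def vec_eq_iff)
  have contF: "continuous_on A (F j)" for A j
  proof -
    have "continuous_on A (\<lambda>t. F j t $ i)" for i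
      using DF by (meson DERIV_isCont continuous_at_imp_continuous_on)
    then have "continuous_on A (\<lambda>t. \<chi> i. F j t $ i)" by (rule continuous_on_vec_lambda)
    then show ?thesis by simp
  qed
  have derivs: "(deriv ^^ j) (\<lambda>t. u \<bullet> f t) = (\<lambda>t. u \<bullet> F j t)" for u j
  proof (induction j)
    case (Suc j)
    then show ?case using D by (auto intro!: DERIV_imp_deriv)
  qed (simp add: F0)
  have ex: "\<exists>d. u \<bullet> F (Suc d) t\<^sub>0 \<noteq> 0" if "u \<in> S" for u
  proof (rule ccontr)
    assume "\<not> ?thesis"
    moreover have "real_analytic (\<lambda>t. u \<bullet> f t)"
      using real_analytic_bounded_linear[OF f bounded_linear_inner_right] .
    ultimately have "u \<bullet> f t = u \<bullet> f t\<^sub>0" for t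
      using real_analytic_constant[of "\<lambda>t. u \<bullet> f t" t\<^sub>0 t] unfolding derivs by auto
    then show False using nonconst[OF that] by auto
  qed
  define U where "U d = {u. u \<bullet> F (Suc d) t\<^sub>0 \<noteq> 0}" for d
  have "open (U d)" for d unfolding U_def by (intro open_Collect_neq continuous_intros)
  moreover have "S \<subseteq> (\<Union>d. U d)" using ex unfolding U_def by auto
  ultimately obtain C where C: "finite C" "S \<subseteq> (\<Union>d\<in>C. U d)"
    using compactE_image[OF S, of UNIV U] by auto
  define N where "N = Max (insert 0 C)"
  have CN: "C \<subseteq> {..N}" unfolding N_def using C by auto
  \<comment> \<open>A single derivative may vanish for some \<open>u\<close>, but the sum over all
    orders up to \<open>Suc N\<close> is continuous and positive on \<open>S\<close>, hence bounded
    below by some \<open>c\<close>.\<close>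
  define M where "M u = (\<Sum>d\<le>N. \<bar>u \<bullet> F (Suc d) t\<^sub>0\<bar>)" for u
  have Mpos: "0 < M u" if "u \<in> S" for u
  proof -
    obtain d where d: "d \<in> C" "u \<bullet> F (Suc d) t\<^sub>0 \<noteq> 0" using C \<open>u \<in> S\<close> unfolding U_def by blast
    then have "0 < \<bar>u \<bullet> F (Suc d) t\<^sub>0\<bar>" by simp
    also have "\<dots> \<le> M u" unfolding M_def using d CN by (intro member_le_sum) auto
    finally show ?thesis .
  qed
  obtain c where c: "0 < c" "\<And>u. u \<in> S \<Longrightarrow> c \<le> M u"
  proof (cases "S = {}")
    case False
    have "continuous_on S M" unfolding M_def by (intro continuous_intros)
    then obtain u0 where "u0 \<in> S" "\<And>u. u \<in> S \<Longrightarrow> M u0 \<le> M u"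
      using continuous_attains_inf[OF S False] by blast
    then show ?thesis using that[of "M u0"] Mpos by blast
  qed (use that[of 1] in auto)
  obtain B where B: "0 < B" "\<And>u. u \<in> S \<Longrightarrow> norm u \<le> B"
    using compact_imp_bounded[OF S] by (meson bounded_pos)
  \<comment> \<open>Pigeonhole: one of the \<open>N + 1\<close> summands is at least
    \<open>2 * \<eta>\<close>. Half of it is given up when \<open>t\<close> moves away from
    \<open>t\<^sub>0\<close>; the minimum with 1 meets the requirement of
    \<open>van_der_Corput\<close>.\<close>
  define \<eta> where "\<eta> = min 1 (c / (2 * (real N + 1)))"
  have \<eta>: "0 < \<eta>" "\<eta> \<le> 1" "2 * \<eta> * (real N + 1) \<le> c"
  proof -
    show "0 < \<eta>" "\<eta> \<le> 1" using c by (auto simp: \<eta>_def)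
    have "2 * \<eta> * (real N + 1) \<le> 2 * (c / (2 * (real N + 1))) * (real N + 1)"
      unfolding \<eta>_def by (intro mult_right_mono mult_left_mono min.cobounded2) auto
    also have "\<dots> = c" by (simp add: divide_simps)
    finally show "2 * \<eta> * (real N + 1) \<le> c" .
  qed
  have ex\<eta>: "\<exists>d\<le>N. 2 * \<eta> \<le> \<bar>u \<bullet> F (Suc d) t\<^sub>0\<bar>" if "u \<in> S" for u
  proof (rule ccontr)
    assume *: "\<not> ?thesis"
    have "\<bar>u \<bullet> F (Suc d) t\<^sub>0\<bar> < 2 * \<eta>" if "d \<le> N" for d using * that by (meson not_le)
    then have "M u < (\<Sum>d\<le>N. 2 * \<eta>)" unfolding M_def by (intro sum_strict_mono) auto
    also have "\<dots> \<le> c" using \<eta> by (simp add: algebra_simps)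
    finally show False using c(2)[OF that] by simp
  qed
  have "\<exists>\<rho>>0. \<forall>t. dist t t\<^sub>0 < \<rho> \<longrightarrow> dist (F (Suc d) t) (F (Suc d) t\<^sub>0) < \<eta> / B" for d
    using contF[of UNIV "Suc d"] divide_pos_pos[OF \<eta>(1) B(1)] unfolding continuous_on_iff by blast
  then obtain \<rho> where \<rho>: "\<And>d. 0 < \<rho> d" "\<And>d t. dist t t\<^sub>0 < \<rho> d \<Longrightarrow> dist (F (Suc d) t) (F (Suc d) t\<^sub>0) < \<eta> / B"
    by metis
  define e where "e = Min (\<rho> ` {..N}) / 2"
  have e: "0 < e" "\<And>d. d \<le> N \<Longrightarrow> e < \<rho> d"
  proof -
    have "0 < Min (\<rho> ` {..N})" using \<rho> by (subst Min_gr_iff) auto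
    then show "0 < e" by (simp add: e_def)
    fix d assume "d \<le> N"
    then have "Min (\<rho> ` {..N}) \<le> \<rho> d" by (intro Min_le) auto
    then show "e < \<rho> d" using \<open>0 < Min (\<rho> ` {..N})\<close> unfolding e_def by linarith
  qed
  define p q where "p = t\<^sub>0 - e" and "q = t\<^sub>0 + e"
  have "compact (F 2 ` {p..q})" by (intro compact_continuous_image contF) simp
  then obtain M2 where M2: "0 < M2" "\<And>t. t \<in> {p..q} \<Longrightarrow> norm (F 2 t) \<le> M2"
    using compact_imp_bounded by (metis bounded_pos imageI)
  define K where "K = 4 ^ N * (2 + B * M2 * (q - p)) / \<eta>\<^sup>2"
  have main: "norm (integral {p..q} (\<lambda>t. cis (\<Lambda> * (u \<bullet> f t)))) \<le> K * \<Lambda> powr (- ((1/3) ^ N))"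
    if u: "u \<in> S" and \<Lambda>: "1 \<le> \<Lambda>" for u \<Lambda>
  proof -
    obtain d where d: "d \<le> N" "2 * \<eta> \<le> \<bar>u \<bullet> F (Suc d) t\<^sub>0\<bar>" using ex\<eta>[OF u] by auto
    have low: "\<eta> \<le> \<bar>u \<bullet> F (Suc d) t\<bar>" if "t \<in> {p<..<q}" for t
    proof -
      have "dist t t\<^sub>0 < \<rho> d" using that e(2)[OF d(1)] unfolding p_def q_def by (auto simp: dist_real_def)
      then have "norm (F (Suc d) t - F (Suc d) t\<^sub>0) \<le> \<eta> / B" using \<rho>(2) by (simp add: dist_norm less_imp_le)
      then have "norm u * norm (F (Suc d) t - F (Suc d) t\<^sub>0) \<le> B * (\<eta> / B)"
        using B u by (intro mult_mono) auto
      then have "\<bar>u \<bullet> (F (Suc d) t - F (Suc d) t\<^sub>0)\<bar> \<le> \<eta>"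
        using Cauchy_Schwarz_ineq2[of u "F (Suc d) t - F (Suc d) t\<^sub>0"] B by simp
      then show ?thesis using d unfolding inner_diff_right by linarith
    qed
    have "\<bar>u \<bullet> F 2 t\<bar> \<le> B * M2" if "t \<in> {p..q}" for t
      using Cauchy_Schwarz_ineq2[of u "F 2 t"] mult_mono[OF B(2)[OF u] M2(2)[OF that]] B by simp
    then have "norm (integral {p..q} (\<lambda>t. cis (\<Lambda> * (u \<bullet> F 0 t))))
      \<le> 4 ^ d * (2 + B * M2 * (q - p)) / \<eta>\<^sup>2 * \<Lambda> powr (- ((1/3) ^ d))"
      using \<Lambda> low \<eta> e B M2
      by (intro van_der_Corput[where G = "\<lambda>j t. u \<bullet> F j t" and a = p and b = q] D)
         (auto simp: p_def q_def)
    \<comment> \<open>The order \<open>d\<close> still depends on \<open>u\<close>; as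
      \<open>1 \<le> \<Lambda>\<close>, the weakest exponent, that of \<open>N\<close>, serves all
      of them.\<close>
    also have "\<dots> \<le> K * \<Lambda> powr (- ((1/3) ^ N))" unfolding K_def
      using \<Lambda> d e B M2
      by (intro mult_mono divide_right_mono mult_right_mono power_increasing powr_mono)
         (auto simp: p_def q_def power_decreasing)
    finally show ?thesis unfolding F0 .
  qed
  have "0 \<le> K" unfolding K_def using B M2 e by (auto simp: p_def q_def)
  moreover have "p < t\<^sub>0" "t\<^sub>0 < q" using e by (auto simp: p_def q_def)
  moreover have "0 < (1/3::real) ^ N" "(1/3::real) ^ N \<le> 1" by (auto simp: power_le_one)
  ultimately show thesis using main by (intro that[of p q "(1/3) ^ N" K])
qed

section \<open>Almost everywhere convergence of averages\<close>

text \<open>For \<open>N\<close> between \<open>M j\<close> and \<open>M (Suc j)\<close> the terms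
  beyond \<open>M j\<close> change the average by at most the ratio of consecutive values minus 1,
  since each term has norm at most 1.\<close>

lemma averages_tendsto_0_of_subsequence:
  fixes z :: "nat \<Rightarrow> complex" and M :: "nat \<Rightarrow> nat"
  assumes z: "\<And>n. norm (z n) \<le> 1" and M: "mono M" "\<And>j. 0 < M j" "filterlim M at_top at_top"
    and ratio: "(\<lambda>j. real (M (Suc j)) / real (M j)) \<longlonglongrightarrow> 1"
    and sub: "(\<lambda>j. (\<Sum>n\<in>{1..M j}. z n) / M j) \<longlonglongrightarrow> 0"
  shows "(\<lambda>N. (\<Sum>n\<in>{1..N}. z n) / N) \<longlonglongrightarrow> 0"
proof (rule LIMSEQ_I)
  fix e :: real assume "0 < e"
  have "(\<lambda>j. norm ((\<Sum>n\<in>{1..M j}. z n) / M j) + (real (M (Suc j)) / real (M j) - 1)) \<longlonglongrightarrow> 0 + (1 - 1)"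
    by (intro tendsto_add tendsto_norm_zero sub tendsto_diff ratio tendsto_const)
  then have "\<forall>\<^sub>F j in sequentially. norm ((\<Sum>n\<in>{1..M j}. z n) / M j) + (real (M (Suc j)) / real (M j) - 1) < e"
    using \<open>0 < e\<close> by (intro order_tendstoD(2)) auto
  then obtain J where J: "\<And>j. J \<le> j \<Longrightarrow> norm ((\<Sum>n\<in>{1..M j}. z n) / M j) + (real (M (Suc j)) / real (M j) - 1) < e"
    by (auto simp: eventually_at_top_linorder)
  show "\<exists>N0. \<forall>N\<ge>N0. norm ((\<Sum>n\<in>{1..N}. z n) / N - 0) < e"
  proof (intro exI[of _ "M J"] allI impI)
    fix N assume N: "M J \<le> N"
    have "\<forall>\<^sub>F j in sequentially. N < M j"
      using M(3)[unfolded filterlim_at_top, rule_format, of "Suc N"] by (simp add: Suc_le_eq)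
    then obtain B where B: "\<And>j. B \<le> j \<Longrightarrow> N < M j" by (auto simp: eventually_at_top_linorder)
    obtain j where j: "M j \<le> N" "\<And>i. M i \<le> N \<Longrightarrow> i \<le> j"
    proof -
      have *: "\<forall>i. M i \<le> N \<longrightarrow> i \<le> B" using B by (meson linorder_not_less nat_le_linear)
      show thesis
        using GreatestI_nat[of "\<lambda>i. M i \<le> N" J B] Greatest_le_nat[of "\<lambda>i. M i \<le> N" _ B] N *
        by (intro that[of "GREATEST i. M i \<le> N"]) auto
    qed
    have "J \<le> j" using j(2) N by blast
    have Suc: "N < M (Suc j)" using j(2)[of "Suc j"] by force
    have pos: "0 < real (M j)" "0 < real N" using M(2)[of j] j(1) by auto
    have "{1..N} = {1..M j} \<union> {Suc (M j)..N}" using j(1) M(2)[of j] by auto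
    then have "(\<Sum>n\<in>{1..N}. z n) = (\<Sum>n\<in>{1..M j}. z n) + (\<Sum>n\<in>{Suc (M j)..N}. z n)"
      by (simp add: sum.union_disjoint)
    moreover have "norm (\<Sum>n\<in>{Suc (M j)..N}. z n) \<le> real (N - M j)"
      using sum_norm_bound[of "{Suc (M j)..N}" z 1] z by simp
    ultimately have "norm (\<Sum>n\<in>{1..N}. z n) \<le> norm (\<Sum>n\<in>{1..M j}. z n) + (real N - real (M j))"
      using norm_triangle_ineq[of "\<Sum>n\<in>{1..M j}. z n" "\<Sum>n\<in>{Suc (M j)..N}. z n"] j(1) by (simp add: of_nat_diff)
    then have "norm ((\<Sum>n\<in>{1..N}. z n) / N) \<le> (norm (\<Sum>n\<in>{1..M j}. z n) + (real N - real (M j))) / real N"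
      using pos by (simp add: norm_divide divide_right_mono)
    also have "\<dots> \<le> (norm (\<Sum>n\<in>{1..M j}. z n) + (real (M (Suc j)) - real (M j))) / real (M j)"
      using pos j(1) Suc by (intro frac_le) auto
    also have "\<dots> = norm ((\<Sum>n\<in>{1..M j}. z n) / M j) + (real (M (Suc j)) / real (M j) - 1)"
      using pos by (simp add: norm_divide field_simps)
    also have "\<dots> < e" using J[OF \<open>J \<le> j\<close>] .
    finally show "norm ((\<Sum>n\<in>{1..N}. z n) / N - 0) < e" by simp
  qed
qed

text \<open>
  The variance bound is summable along \<open>N\<^sub>j = \<lceil>exp (j\<^sup>\<beta>)\<rceil>\<close> when \<open>\<beta> (1 + \<epsilon>) > 1\<close>, while
  \<open>N\<^sub>j\<^sub>+\<^sub>1 / N\<^sub>j \<longrightarrow> 1\<close> when \<open>\<beta> < 1\<close>.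
\<close>

lemma AE_averages_tendsto_0:
  fixes g :: "nat \<Rightarrow> real \<Rightarrow> complex"
  assumes cont: "\<And>n. continuous_on {p..q} (g n)" and bound: "\<And>n t. norm (g n t) \<le> 1"
    and "0 < \<epsilon>" "0 \<le> C"
    and var: "\<forall>\<^sub>F N in sequentially.
      integral {p..q} (\<lambda>t. (norm ((\<Sum>n\<in>{1..N}. g n t) / N))\<^sup>2) \<le> C / (ln (real N)) powr (1 + \<epsilon>)"
  shows "AE t in lborel. t \<in> {p..q} \<longrightarrow> (\<lambda>N. (\<Sum>n\<in>{1..N}. g n t) / N) \<longlonglongrightarrow> 0"
proof -
  \<comment> \<open>Any number strictly between 1 / (1 + \<epsilon>) and 1 would do.\<close>
  define \<beta> where "\<beta> = 1 / (1 + \<epsilon> / 2)"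
  have \<beta>: "0 < \<beta>" "\<beta> < 1" "1 < \<beta> * (1 + \<epsilon>)" using \<open>0 < \<epsilon>\<close> by (auto simp: \<beta>_def field_simps)
  define M where "M j = nat \<lceil>exp (real j powr \<beta>)\<rceil>" for j
  have M_ge: "exp (real j powr \<beta>) \<le> real (M j)" for j unfolding M_def by linarith
  have M_le: "real (M j) \<le> exp (real j powr \<beta>) + 1" for j
    unfolding M_def using of_int_ceiling_le_add_one[of "exp (real j powr \<beta>)"] by simp
  have Mpos: "0 < M j" for j using M_ge[of j] exp_gt_zero[of "real j powr \<beta>"] by linarith
  have "mono M" unfolding M_def
    by (intro monoI nat_mono ceiling_mono) (auto intro!: powr_mono2 simp: less_imp_le[OF \<beta>(1)])
  have Mlim: "filterlim M at_top at_top"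
  proof -
    have "filterlim (\<lambda>j. exp (real j powr \<beta>)) at_top at_top" using \<beta>(1) by real_asymp
    then have "filterlim (\<lambda>j. real (M j)) at_top at_top"
      by (rule filterlim_at_top_mono) (simp add: M_ge)
    then show ?thesis by (simp add: filterlim_sequentially_iff_filterlim_real)
  qed
  have ratio: "(\<lambda>j. real (M (Suc j)) / real (M j)) \<longlonglongrightarrow> 1"
  proof (rule tendsto_sandwich)
    show "\<forall>\<^sub>F j in sequentially. 1 \<le> real (M (Suc j)) / real (M j)"
      using \<open>mono M\<close> Mpos by (auto simp: mono_iff_le_Suc)
    show "\<forall>\<^sub>F j in sequentially. real (M (Suc j)) / real (M j) \<le> (exp (real (Suc j) powr \<beta>) + 1) / exp (real j powr \<beta>)"
      by (intro always_eventually allI frac_le M_le M_ge) (auto simp: add_nonneg_nonneg)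
    show "(\<lambda>j. (exp (real (Suc j) powr \<beta>) + 1) / exp (real j powr \<beta>)) \<longlonglongrightarrow> 1"
      using \<beta>(1,2) by real_asymp
  qed simp
  define S where "S j t = (norm ((\<Sum>n\<in>{1..M j}. g n t) / M j))\<^sup>2" for j t
  have contS: "continuous_on {p..q} (S j)" for j unfolding S_def
    using Mpos by (intro continuous_intros cont) auto
  have nnS: "(\<integral>\<^sup>+t. ennreal (indicator {p..q} t * S j t) \<partial>lborel) = ennreal (integral {p..q} (S j))" for j
  proof -
    have "((\<lambda>t. if t \<in> {p..q} then S j t else 0) has_integral integral {p..q} (S j)) UNIV"
      using integrable_continuous_interval[OF contS] by (simp only: has_integral_restrict_UNIV) (rule integrable_integral)
    then have "((\<lambda>t. indicator {p..q} t * S j t) has_integral integral {p..q} (S j)) UNIV"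
      by (rule has_integral_eq[rotated]) (simp add: indicator_def)
    then show ?thesis
      using borel_measurable_continuous_on_indicator[OF _ contS]
      by (intro nn_integral_has_integral_lborel) (auto simp: S_def)
  qed
  have Spos: "0 \<le> integral {p..q} (S j)" for j
    using integrable_continuous_interval[OF contS] by (rule integral_nonneg) (simp add: S_def)
  have "summable (\<lambda>j. C * real j powr (- (\<beta> * (1 + \<epsilon>))))"
    using \<beta>(3) by (intro summable_mult) (simp add: summable_real_powr_iff)
  moreover have "\<forall>\<^sub>F j in sequentially. norm (integral {p..q} (S j)) \<le> C * real j powr (- (\<beta> * (1 + \<epsilon>)))"
    using filterlim_iff[THEN iffD1, OF Mlim, rule_format, OF var] eventually_gt_at_top[of 0]
  proof eventually_elim
    case (elim j)
    have ln_ge: "real j powr \<beta> \<le> ln (real (M j))" using M_ge[of j] Mpos[of j] by (simp add: ln_ge_iff)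
    have jpos: "0 < real j powr \<beta>" using elim by simp
    from ln_ge have "(real j powr \<beta>) powr (1 + \<epsilon>) \<le> ln (real (M j)) powr (1 + \<epsilon>)"
      using \<open>0 < \<epsilon>\<close> by (intro powr_mono2) auto
    then have "C / ln (real (M j)) powr (1 + \<epsilon>) \<le> C / (real j powr \<beta>) powr (1 + \<epsilon>)"
      using ln_ge jpos \<open>0 \<le> C\<close> by (intro divide_left_mono mult_pos_pos) auto
    also have "\<dots> = C * real j powr (- (\<beta> * (1 + \<epsilon>)))" by (simp add: powr_powr powr_minus divide_inverse)
    finally have "integral {p..q} (S j) \<le> C * real j powr (- (\<beta> * (1 + \<epsilon>)))" using elim(1) unfolding S_def by linarith
    moreover have "0 \<le> integral {p..q} (S j)" by (rule Spos)
    ultimately show ?case by simp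
  qed
  ultimately have "summable (\<lambda>j. integral {p..q} (S j))"
    by (rule summable_comparison_test_ev[rotated])
  moreover note Spos
  ultimately have "(\<Sum>j. ennreal (integral {p..q} (S j))) < \<infinity>"
    by (simp add: suminf_ennreal2 ennreal_less_top)
  moreover have [measurable]: "(\<lambda>t. ennreal (indicator {p..q} t * S j t)) \<in> borel_measurable lborel" for j
    using borel_measurable_continuous_on_indicator[OF _ contS, of j] by simp
  \<comment> \<open>Summability of the mean squares makes the sum of the squared averages
    integrable, hence finite almost everywhere, so that its terms tend to 0.\<close>
  ultimately have "(\<integral>\<^sup>+t. (\<Sum>j. ennreal (indicator {p..q} t * S j t)) \<partial>lborel) \<noteq> \<infinity>"
    by (subst nn_integral_suminf) (auto simp: nnS)
  then have "AE t in lborel. (\<Sum>j. ennreal (indicator {p..q} t * S j t)) \<noteq> \<infinity>"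
    by (intro nn_integral_PInf_AE) auto
  then show ?thesis
  proof eventually_elim
    case (elim t)
    show ?case
    proof
      assume t: "t \<in> {p..q}"
      then have "(\<Sum>j. ennreal (S j t)) \<noteq> top" using elim by simp
      then have "summable (\<lambda>j. S j t)" by (intro summable_suminf_not_top) (auto simp: S_def)
      then have "(\<lambda>j. S j t) \<longlonglongrightarrow> 0" by (rule summable_LIMSEQ_zero)
      then have "(\<lambda>j. sqrt (S j t)) \<longlonglongrightarrow> sqrt 0" by (intro tendsto_real_sqrt)
      then have "(\<lambda>j. (\<Sum>n\<in>{1..M j}. g n t) / M j) \<longlonglongrightarrow> 0"
        by (simp add: S_def tendsto_norm_zero_iff)
      then show "(\<lambda>N. (\<Sum>n\<in>{1..N}. g n t) / N) \<longlonglongrightarrow> 0"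
        by (intro averages_tendsto_0_of_subsequence[of _ M] bound \<open>mono M\<close> Mpos Mlim ratio)
    qed
  qed
qed

section \<open>Weyl's criterion\<close>

text \<open>Values are real, to be compared with an indicator function, while the expansion is
  complex. Index set and coefficients are explicit parameters because a product over the coordinates
  is later expanded over all choices of indices.\<close>

definition trig_poly :: "(real \<Rightarrow> real) \<Rightarrow> int set \<Rightarrow> (int \<Rightarrow> complex) \<Rightarrow> bool" where
  "trig_poly T J c \<longleftrightarrow> finite J \<and> (\<forall>x. complex_of_real (T x) = (\<Sum>j\<in>J. c j * cis (2 * pi * j * x)))"

lemma trig_poly_const: "trig_poly (\<lambda>x. a) {0} (\<lambda>j. of_real a)"
  by (simp add: trig_poly_def)

lemma trig_poly_add:
  assumes "trig_poly T J c" "trig_poly U K d"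
  shows "trig_poly (\<lambda>x. T x + U x) (J \<union> K) (\<lambda>j. (if j \<in> J then c j else 0) + (if j \<in> K then d j else 0))"
proof -
  have fin: "finite J" "finite K" using assms by (auto simp: trig_poly_def)
  have "(\<Sum>j\<in>J \<union> K. (if j \<in> J then c j else 0) * cis (2 * pi * j * x)) = (\<Sum>j\<in>J. c j * cis (2 * pi * j * x))" for x
    using fin by (intro sum.mono_neutral_cong_right) auto
  moreover have "(\<Sum>j\<in>J \<union> K. (if j \<in> K then d j else 0) * cis (2 * pi * j * x)) = (\<Sum>j\<in>K. d j * cis (2 * pi * j * x))" for x
    using fin by (intro sum.mono_neutral_cong_right) auto
  ultimately show ?thesis
    using assms by (simp add: trig_poly_def distrib_right sum.distrib)
qed

lemma trig_poly_mult:
  assumes "trig_poly T J c" "trig_poly U K d"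
  shows "trig_poly (\<lambda>x. T x * U x) ((\<lambda>(j, k). j + k) ` (J \<times> K))
    (\<lambda>m. \<Sum>(j, k) | (j, k) \<in> J \<times> K \<and> j + k = m. c j * d k)"
proof -
  have fin: "finite J" "finite K" using assms by (auto simp: trig_poly_def)
  have "complex_of_real (T x * U x) = (\<Sum>m\<in>(\<lambda>(j, k). j + k) ` (J \<times> K).
      (\<Sum>(j, k) | (j, k) \<in> J \<times> K \<and> j + k = m. c j * d k) * cis (2 * pi * m * x))" for x
  proof -
    have "complex_of_real (T x * U x) = (\<Sum>j\<in>J. \<Sum>k\<in>K. (c j * cis (2 * pi * j * x)) * (d k * cis (2 * pi * k * x)))"
      using assms by (simp add: trig_poly_def sum_product)
    also have "\<dots> = (\<Sum>(j, k)\<in>J \<times> K. c j * d k * cis (2 * pi * (j + k) * x))"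
      unfolding sum.cartesian_product
      by (intro sum.cong refl) (auto simp: algebra_simps simp flip: cis_mult)
    also have "\<dots> = (\<Sum>m\<in>(\<lambda>(j, k). j + k) ` (J \<times> K).
        \<Sum>p\<in>{p \<in> J \<times> K. (case p of (j, k) \<Rightarrow> j + k) = m}. case p of (j, k) \<Rightarrow> c j * d k * cis (2 * pi * (j + k) * x))"
      using fin by (intro sum.group[symmetric]) auto
    also have "\<dots> = (\<Sum>m\<in>(\<lambda>(j, k). j + k) ` (J \<times> K).
        (\<Sum>(j, k) | (j, k) \<in> J \<times> K \<and> j + k = m. c j * d k) * cis (2 * pi * m * x))"
      unfolding sum_distrib_right by (intro sum.cong refl) (auto intro!: sum.cong simp flip: of_int_add)
    finally show ?thesis .
  qed
  then show ?thesis using fin by (simp add: trig_poly_def)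
qed

text \<open>Carries Stone-Weierstrass approximation on the unit circle over to trigonometric
  polynomials. The computation lies in the linear case, where the frequencies 1 and -1 come from
  Euler's formulas.\<close>

lemma trig_poly_polynomial:
  assumes "real_polynomial_function g"
  shows "\<exists>J c. trig_poly (\<lambda>x. g (cis (2 * pi * x))) J c"
  using assms
proof induction
  case (linear g)
  interpret bounded_linear g by fact
  have "g (cis (2 * pi * x)) = cos (2 * pi * x) * g 1 + sin (2 * pi * x) * g \<i>" for x
  proof -
    have "cis (2 * pi * x) = cos (2 * pi * x) *\<^sub>R 1 + sin (2 * pi * x) *\<^sub>R \<i>"
      by (simp add: complex_eq_iff)
    then show ?thesis by (simp only: add scaleR real_scaleR_def)
  qed
  moreover have "complex_of_real (cos y * g 1 + sin y * g \<i>)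
      = (g 1 / 2 + g \<i> / (2 * \<i>)) * cis y + (g 1 / 2 - g \<i> / (2 * \<i>)) * cis (- y)" for y
    by (simp add: complex_eq_iff Re_divide Im_divide power2_eq_square)
  ultimately have "trig_poly (\<lambda>x. g (cis (2 * pi * x))) {1, -1}
      (\<lambda>j. if j = 1 then g 1 / 2 + g \<i> / (2 * \<i>) else g 1 / 2 - g \<i> / (2 * \<i>))"
    unfolding trig_poly_def by simp
  then show ?case by blast
next
  case (const c)
  then show ?case using trig_poly_const by blast
next
  case (add f g)
  then show ?case using trig_poly_add by blast
next
  case (mult f g)
  then show ?case using trig_poly_mult by blast
qed

lemma integral_cis_unit_interval:
  "((\<lambda>x. cis (2 * pi * real_of_int j * x)) has_integral (if j = 0 then 1 else 0)) {0..1}"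
proof (cases "j = 0")
  case True
  then show ?thesis using has_integral_const_real[of "1::complex" 0 1] by simp
next
  case False
  define F where "F x = cis (2 * pi * j * x) / (2 * pi * j * \<i>)" for x
  have "(F has_vector_derivative cis (2 * pi * j * x)) (at x within {0..1})" for x
    unfolding F_def has_vector_derivative_def
    using False
    by (auto intro!: derivative_eq_intros simp: scaleR_conv_of_real fun_eq_iff) (simp add: complex_eq_iff)
  then have "((\<lambda>x. cis (2 * pi * j * x)) has_integral F 1 - F 0) {0..1}"
    by (intro fundamental_theorem_of_calculus) auto
  moreover have "cis (2 * pi * j) = 1" by (intro cis_multiple_2pi) simp
  ultimately show ?thesis using False by (simp add: F_def)
qed

text \<open>Orthogonality leaves the coefficient of frequency 0. It is written as a sum with
  \<open>of_bool\<close> because 0 need not lie in \<open>J\<close>, and because the product over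
  the coordinates expands in this shape.\<close>

lemma trig_poly_integral:
  assumes "trig_poly T J c"
  shows "(\<Sum>j\<in>J. c j * of_bool (j = 0)) = complex_of_real (integral {0..1} T)" and "T integrable_on {0..1}"
proof -
  have "((\<lambda>x. complex_of_real (T x)) has_integral (\<Sum>j\<in>J. c j * (if j = 0 then 1 else 0))) {0..1}"
    using assms unfolding trig_poly_def
    by (auto intro!: has_integral_sum has_integral_mult_right integral_cis_unit_interval)
  then obtain Z where Z: "(\<Sum>j\<in>J. c j * of_bool (j = 0)) = Z"
    and I: "((\<lambda>x. complex_of_real (T x)) has_integral Z) {0..1}"
    by (simp add: of_bool_def)
  have "(T has_integral Re Z) {0..1}" using has_integral_linear[OF I bounded_linear_Re] by (simp add: o_def)
  moreover have "Im Z = 0" using has_integral_linear[OF I bounded_linear_Im] by (simp add: o_def)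
  ultimately show "(\<Sum>j\<in>J. c j * of_bool (j = 0)) = complex_of_real (integral {0..1} T)" "T integrable_on {0..1}"
    unfolding Z by (auto simp: complex_eq_iff integral_unique)
qed

section \<open>One-sided approximation of sets in the unit interval\<close>

lemma cis_2pi_frac: "cis (2 * pi * frac x) = cis (2 * pi * x)"
proof -
  have "cis (2 * pi * x) = cis (2 * pi * frac x) * cis (2 * pi * of_int \<lfloor>x\<rfloor>)"
    by (simp add: cis_mult frac_def algebra_simps)
  also have "cis (2 * pi * of_int \<lfloor>x\<rfloor>) = 1" by (intro cis_multiple_2pi) simp
  finally show ?thesis by simp
qed

lemma cis_2pi_inj_on: "inj_on (\<lambda>x. cis (2 * pi * x)) {0..<1}"
proof (rule inj_onI)
  fix x y :: real assume xy: "x \<in> {0..<1}" "y \<in> {0..<1}" "cis (2 * pi * x) = cis (2 * pi * y)"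
  then have "cis (2 * pi * x - 2 * pi * y) = 1" by (simp flip: cis_divide)
  then have "cos (2 * pi * x - 2 * pi * y) = 1" by (simp add: complex_eq_iff)
  then obtain n :: int where "2 * pi * x - 2 * pi * y = n * 2 * pi" using cos_one_2pi_int by auto
  then have "2 * pi * (x - y) = 2 * pi * n" by (simp add: algebra_simps)
  then have "x - y = n" by simp
  moreover from this xy have "real_of_int n < 1" "-1 < real_of_int n" by auto
  then have "n = 0" by linarith
  ultimately show "x = y" by simp
qed

text \<open>Working on the circle makes the approximants periodic. Tent functions around the image
  of the closure of \<open>B\<close> converge to its indicator, so their integrals approach the
  measure of the closure; a polynomial close to a slightly raised tent stays above it.\<close>

lemma trig_majorant:
  fixes B :: "real set"
  assumes B: "B \<subseteq> {0..1}" and "0 < \<epsilon>"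
  obtains T J c where "trig_poly T J c" "\<And>x. 0 \<le> T x" "\<And>x. frac x \<in> B \<Longrightarrow> 1 \<le> T x"
    "integral {0..1} T \<le> measure lebesgue (closure B) + \<epsilon>"
proof (cases "B = {}")
  \<comment> \<open>\<open>infdist\<close> to the empty set is 0 by convention, which would make the
    tents below identically 1.\<close>
  case True
  show ?thesis
    by (rule that[OF trig_poly_const[of 0]]) (use True \<open>0 < \<epsilon>\<close> in auto)
next
  case False
  define e where "e x = cis (2 * pi * x)" for x
  define A where "A = e ` closure B"
  have clB: "closure B \<subseteq> {0..1}" using B by (simp add: closure_minimal)
  have "compact (closure B)" using bounded_subset[OF bounded_closed_interval B] by simp
  have cont_e: "continuous_on X e" for X unfolding e_def by (intro continuous_intros)
  have A: "compact A" "A \<noteq> {}" unfolding A_def using \<open>compact (closure B)\<close> cont_e False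
    by (auto intro!: compact_continuous_image)
  define \<psi> where "\<psi> m z = max 0 (1 - real m * infdist z A)" for m z
  have cont: "continuous_on X (\<psi> m)" for X m unfolding \<psi>_def by (intro continuous_intros)
  have contpsi: "continuous_on X (\<lambda>x. \<psi> m (e x))" for X m
    using continuous_on_compose2[OF cont cont_e] by blast
  have bound: "0 \<le> \<psi> m z" "\<psi> m z \<le> 1" for m z unfolding \<psi>_def by (auto simp: infdist_nonneg)
  have lim: "(\<lambda>m. \<psi> m z) \<longlonglongrightarrow> indicator A z" for z
  proof (cases "z \<in> A")
    case True
    then show ?thesis by (simp add: \<psi>_def)
  next
    case False
    then have "0 < infdist z A" using infdist_pos_not_in_closed[OF compact_imp_closed[OF A(1)] A(2)] by simp
    then obtain M where M: "1 < real M * infdist z A" using reals_Archimedean3 by blast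
    have "\<psi> m z = 0" if "M \<le> m" for m
    proof -
      have "real M * infdist z A \<le> real m * infdist z A" using that by (intro mult_right_mono) (auto simp: infdist_nonneg)
      then show ?thesis using M unfolding \<psi>_def by simp
    qed
    then show ?thesis using False by (intro tendsto_eventually) (auto simp: eventually_at_top_linorder)
  qed
  have "(\<lambda>m. integral {0..1} (\<lambda>x. \<psi> m (e x))) \<longlonglongrightarrow> integral {0..1} (\<lambda>x. indicator A (e x))"
    by (rule dominated_convergence(2)[where h = "\<lambda>_. 1"])
       (use bound lim contpsi in \<open>auto intro: integrable_continuous_interval\<close>)
  also have "integral {0..1} (\<lambda>x. indicator A (e x) :: real) = integral {0..1} (indicator (closure B))"
  \<comment> \<open>\<open>e\<close> identifies 0 with 1, so membership in \<open>A\<close> and in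
    \<open>closure B\<close> can disagree only at these two points.\<close>
  proof (rule integral_spike[of "{0, 1}"])
    fix x :: real assume x: "x \<in> {0..1} - {0, 1}"
    have "e x \<in> A \<longleftrightarrow> x \<in> closure B"
    proof
      assume "e x \<in> A"
      then obtain y where y: "y \<in> closure B" "e x = e y" unfolding A_def by auto
      show "x \<in> closure B"
      proof (cases "y = 1")
        case True
        then have "e x = e 0" using y by (simp add: e_def)
        then have "x = 0" using x inj_onD[OF cis_2pi_inj_on, of x 0] unfolding e_def by auto
        then show ?thesis using x by auto
      next
        case False
        then have "y \<in> {0..<1}" using y clB by force
        then show ?thesis using x y inj_onD[OF cis_2pi_inj_on, of x y] unfolding e_def by auto
      qed
    qed (auto simp: A_def)
    then show "indicator (closure B) x = (indicator A (e x) :: real)" by (simp add: indicator_def)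
  qed simp
  also have "\<dots> = measure lebesgue (closure B)"
    using clB \<open>compact (closure B)\<close> by (subst Equivalence_Lebesgue_Henstock_Integration.integral_indicator)
      (auto simp: Int_absorb2 lmeasurable_compact)
  finally have "\<forall>\<^sub>F m in sequentially. integral {0..1} (\<lambda>x. \<psi> m (e x)) < measure lebesgue (closure B) + \<epsilon> / 2"
    by (rule order_tendstoD(2)) (simp add: \<open>0 < \<epsilon>\<close>)
  then obtain m where m: "integral {0..1} (\<lambda>x. \<psi> m (e x)) < measure lebesgue (closure B) + \<epsilon> / 2"
    by (meson eventually_at_top_linorder order_refl)
  \<comment> \<open>Raising the target by \<open>\<epsilon> / 4\<close> turns the two-sided error
    \<open>\<epsilon> / 4\<close> into a majorant exceeding \<open>\<psi> m\<close> by at most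
    \<open>\<epsilon> / 2\<close> on the circle.\<close>
  obtain g where g: "real_polynomial_function g" "\<And>z. z \<in> sphere 0 1 \<Longrightarrow> \<bar>(\<psi> m z + \<epsilon> / 4) - g z\<bar> < \<epsilon> / 4"
  proof (rule Stone_Weierstrass_real_polynomial_function[of "sphere (0::complex) 1" "\<lambda>z. \<psi> m z + \<epsilon> / 4" "\<epsilon> / 4"])
    show "continuous_on (sphere 0 1) (\<lambda>z. \<psi> m z + \<epsilon> / 4)" by (intro continuous_intros cont)
  qed (use \<open>0 < \<epsilon>\<close> that in auto)
  have ge: "\<psi> m (e x) \<le> g (e x)" "g (e x) \<le> \<psi> m (e x) + \<epsilon> / 2" for x
  proof -
    have "\<bar>(\<psi> m (e x) + \<epsilon> / 4) - g (e x)\<bar> < \<epsilon> / 4" using g(2)[of "e x"] by (simp add: e_def)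
    then show "\<psi> m (e x) \<le> g (e x)" "g (e x) \<le> \<psi> m (e x) + \<epsilon> / 2" by arith+
  qed
  obtain J c where J: "trig_poly (\<lambda>x. g (e x)) J c" using trig_poly_polynomial[OF g(1)] unfolding e_def by blast
  show ?thesis
  proof (rule that[OF J])
    show "0 \<le> g (e x)" for x using ge(1)[of x] bound(1)[of m "e x"] by linarith
    show "1 \<le> g (e x)" if "frac x \<in> B" for x
    proof -
      have "e (frac x) \<in> A" using that closure_subset unfolding A_def by blast
      then have "e x \<in> A" by (simp add: e_def cis_2pi_frac)
      then have "\<psi> m (e x) = 1" by (simp add: \<psi>_def)
      then show ?thesis using ge(1)[of x] by simp
    qed
    have "integral {0..1} (\<lambda>x. g (e x)) \<le> integral {0..1} (\<lambda>x. \<psi> m (e x) + \<epsilon> / 2)"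
      using ge contpsi
      by (intro integral_le trig_poly_integral(2)[OF J] integrable_continuous_interval continuous_intros) auto
    also have "\<dots> = integral {0..1} (\<lambda>x. \<psi> m (e x)) + \<epsilon> / 2"
      using contpsi by (subst integral_add) (auto intro: integrable_continuous_interval)
    finally show "integral {0..1} (\<lambda>x. g (e x)) \<le> measure lebesgue (closure B) + \<epsilon>" using m by linarith
  qed
qed

text \<open>A product of one-dimensional non-negative majorants dominates the indicator of the box.
  It expands into finitely many characters; by hypothesis their averages die out except at frequency
  0, where the product of the integrals remains.\<close>

lemma box_frequency_upper:
  fixes x :: "nat \<Rightarrow> real ^ 'k" and B :: "'k::finite \<Rightarrow> real set"
  assumes weyl: "\<And>h :: 'k \<Rightarrow> int. \<exists>i. h i \<noteq> (0::int) \<Longrightarrow>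
      (\<lambda>N. (\<Sum>n\<in>{1..N}. cis (2 * pi * (\<Sum>i\<in>UNIV. h i * x n $ i))) / N) \<longlonglongrightarrow> 0"
    and B: "\<And>i. B i \<subseteq> {0..1}" and "0 < \<epsilon>"
  shows "\<forall>\<^sub>F N in sequentially. real (card {n \<in> {1..N}. \<forall>i. frac (x n $ i) \<in> B i}) / real N
      \<le> (\<Prod>i\<in>UNIV. measure lebesgue (closure (B i))) + \<epsilon>"
proof -
  define m where "m i = measure lebesgue (closure (B i))" for i
  \<comment> \<open>The error \<open>\<eta>\<close> allowed in each coordinate is found from the
    continuity of the product at 0.\<close>
  have "((\<lambda>\<eta>. \<Prod>i\<in>UNIV. (m i + \<eta>)) \<longlongrightarrow> (\<Prod>i\<in>UNIV. (m i + 0))) (at_right 0)"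
    by (intro tendsto_prod tendsto_add tendsto_const) simp
  then have "\<forall>\<^sub>F \<eta> in at_right 0. (\<Prod>i\<in>UNIV. (m i + \<eta>)) < (\<Prod>i\<in>UNIV. m i) + \<epsilon>"
    using \<open>0 < \<epsilon>\<close> by (intro order_tendstoD(2)) auto
  then have "\<exists>\<eta>>0. (\<Prod>i\<in>UNIV. (m i + \<eta>)) < (\<Prod>i\<in>UNIV. m i) + \<epsilon>"
    unfolding eventually_at_right_field by (metis dense)
  then obtain \<eta> where \<eta>: "0 < \<eta>" "(\<Prod>i\<in>UNIV. (m i + \<eta>)) < (\<Prod>i\<in>UNIV. m i) + \<epsilon>" by blast
  have "\<exists>T J c. trig_poly T J c \<and> (\<forall>x. 0 \<le> T x) \<and> (\<forall>x. frac x \<in> B i \<longrightarrow> 1 \<le> T x) \<and>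
      integral {0..1} T \<le> m i + \<eta>" for i
    using trig_majorant[OF B \<eta>(1), of i] unfolding m_def by metis
  then obtain T J c where T: "\<And>i. trig_poly (T i) (J i) (c i)" "\<And>i x. 0 \<le> T i x"
    "\<And>i x. frac x \<in> B i \<Longrightarrow> 1 \<le> T i x" "\<And>i. integral {0..1} (T i) \<le> m i + \<eta>"
    by metis
  have fin: "finite (J i)" for i using T(1) by (auto simp: trig_poly_def)
  define H where "H = PiE UNIV J"
  define E where "E h N = (\<Sum>n\<in>{1..N}. cis (2 * pi * (\<Sum>i\<in>UNIV. h i * x n $ i))) / N" for h :: "'k \<Rightarrow> int" and N :: nat
  define P where "P y = (\<Prod>i\<in>UNIV. T i (y $ i))" for y :: "real ^ 'k"
  have P: "complex_of_real (P y) = (\<Sum>h\<in>H. (\<Prod>i\<in>UNIV. c i (h i)) * cis (2 * pi * (\<Sum>i\<in>UNIV. h i * y $ i)))" for y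
  proof -
    have "complex_of_real (P y) = (\<Prod>i\<in>UNIV. \<Sum>j\<in>J i. c i j * cis (2 * pi * j * y $ i))"
      using T(1) by (simp add: P_def trig_poly_def)
    also have "\<dots> = (\<Sum>h\<in>H. \<Prod>i\<in>UNIV. c i (h i) * cis (2 * pi * h i * y $ i))"
      unfolding H_def by (rule prod_sum_PiE) (auto simp: fin)
    also have "(\<lambda>h. \<Prod>i\<in>UNIV. c i (h i) * cis (2 * pi * h i * y $ i))
      = (\<lambda>h. (\<Prod>i\<in>UNIV. c i (h i)) * cis (2 * pi * (\<Sum>i\<in>UNIV. h i * y $ i)))"
      by (simp add: prod.distrib cis_conv_exp exp_sum[symmetric] sum_distrib_left mult.assoc)
    finally show ?thesis .
  qed
  have "complex_of_real ((\<Sum>n\<in>{1..N}. P (x n)) / N) = (\<Sum>h\<in>H. (\<Prod>i\<in>UNIV. c i (h i)) * E h N)" for N :: nat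
  proof -
    have "complex_of_real ((\<Sum>n\<in>{1..N}. P (x n)) / N)
      = (\<Sum>n\<in>{1..N}. \<Sum>h\<in>H. (\<Prod>i\<in>UNIV. c i (h i)) * cis (2 * pi * (\<Sum>i\<in>UNIV. h i * x n $ i))) / N"
      by (simp only: of_real_divide of_real_sum P of_real_of_nat_eq)
    also have "\<dots> = (\<Sum>h\<in>H. \<Sum>n\<in>{1..N}. (\<Prod>i\<in>UNIV. c i (h i)) * cis (2 * pi * (\<Sum>i\<in>UNIV. h i * x n $ i))) / N"
      by (subst sum.swap) (rule refl)
    finally show ?thesis by (simp only: E_def sum_divide_distrib sum_distrib_left times_divide_eq_right)
  qed
  moreover have "(\<lambda>N. E h N) \<longlonglongrightarrow> of_bool (\<forall>i. h i = 0)" for h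
  proof (cases "\<forall>i. h i = 0")
    case True
    have "\<forall>\<^sub>F N in sequentially. E h N = 1"
      using eventually_gt_at_top[of 0] by eventually_elim (simp add: E_def True)
    then show ?thesis using True by (simp add: tendsto_eventually)
  next
    case False
    then have "\<exists>i. h i \<noteq> 0" by auto
    moreover have "of_bool (\<forall>i. h i = 0) = (0 :: complex)" using False by simp
    ultimately show ?thesis using weyl[of h] by (simp only: E_def)
  qed
  then have "(\<lambda>N. \<Sum>h\<in>H. (\<Prod>i\<in>UNIV. c i (h i)) * E h N)
      \<longlonglongrightarrow> (\<Sum>h\<in>H. (\<Prod>i\<in>UNIV. c i (h i)) * of_bool (\<forall>i. h i = 0))"
    by (intro tendsto_sum tendsto_mult tendsto_const)
  moreover have "(\<Sum>h\<in>H. (\<Prod>i\<in>UNIV. c i (h i)) * of_bool (\<forall>i. h i = 0)) = of_real (\<Prod>i\<in>UNIV. integral {0..1} (T i))"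
  proof -
    have "of_real (\<Prod>i\<in>UNIV. integral {0..1} (T i)) = (\<Prod>i\<in>UNIV. \<Sum>j\<in>J i. c i j * of_bool (j = 0))"
      using trig_poly_integral(1)[OF T(1)] by simp
    also have "\<dots> = (\<Sum>h\<in>H. \<Prod>i\<in>UNIV. c i (h i) * of_bool (h i = 0))"
      unfolding H_def by (rule prod_sum_PiE) (auto simp: fin)
    also have "\<dots> = (\<Sum>h\<in>H. (\<Prod>i\<in>UNIV. c i (h i)) * of_bool (\<forall>i. h i = 0))"
    proof (rule sum.cong[OF refl])
      fix h :: "'k \<Rightarrow> int"
      have "(\<Prod>i\<in>UNIV. of_bool (h i = 0) :: complex) = of_bool (\<forall>i. h i = 0)"
      proof (cases "\<forall>i. h i = 0")
        case False
        then have "(\<Prod>i\<in>UNIV. of_bool (h i = 0) :: complex) = 0" by (intro prod_zero) auto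
        then show ?thesis using False by simp
      qed simp
      then show "(\<Prod>i\<in>UNIV. c i (h i) * of_bool (h i = 0)) = (\<Prod>i\<in>UNIV. c i (h i)) * of_bool (\<forall>i. h i = 0)"
        by (simp add: prod.distrib)
    qed
    finally show ?thesis by simp
  qed
  ultimately have "(\<lambda>N. complex_of_real ((\<Sum>n\<in>{1..N}. P (x n)) / N)) \<longlonglongrightarrow> of_real (\<Prod>i\<in>UNIV. integral {0..1} (T i))"
    by simp
  then have "(\<lambda>N. (\<Sum>n\<in>{1..N}. P (x n)) / N) \<longlonglongrightarrow> (\<Prod>i\<in>UNIV. integral {0..1} (T i))"
    by (simp only: tendsto_of_real_iff)
  moreover have "(\<Prod>i\<in>UNIV. integral {0..1} (T i)) < (\<Prod>i\<in>UNIV. m i) + \<epsilon>"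
  proof -
    have "0 \<le> integral {0..1} (T i)" for i
      using trig_poly_integral(2)[OF T(1)] T(2) by (intro integral_nonneg) auto
    then have "(\<Prod>i\<in>UNIV. integral {0..1} (T i)) \<le> (\<Prod>i\<in>UNIV. (m i + \<eta>))"
      using T(4) by (intro prod_mono) auto
    then show ?thesis using \<eta>(2) by linarith
  qed
  ultimately have "\<forall>\<^sub>F N in sequentially. (\<Sum>n\<in>{1..N}. P (x n)) / real N < (\<Prod>i\<in>UNIV. m i) + \<epsilon>"
    by (rule order_tendstoD(2))
  then show ?thesis
  proof eventually_elim
    case (elim N)
    have "real (card {n \<in> {1..N}. \<forall>i. frac (x n $ i) \<in> B i}) = (\<Sum>n | n \<in> {1..N} \<and> (\<forall>i. frac (x n $ i) \<in> B i). 1)"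
      by simp
    also have "\<dots> \<le> (\<Sum>n | n \<in> {1..N} \<and> (\<forall>i. frac (x n $ i) \<in> B i). P (x n))"
    proof (rule sum_mono)
      fix n assume "n \<in> {n. n \<in> {1..N} \<and> (\<forall>i. frac (x n $ i) \<in> B i)}"
      then have "(\<Prod>i\<in>(UNIV :: 'k set). 1) \<le> P (x n)" unfolding P_def using T(3) by (intro prod_mono) auto
      then show "1 \<le> P (x n)" by simp
    qed
    also have "\<dots> \<le> (\<Sum>n\<in>{1..N}. P (x n))"
      by (rule sum_mono2) (auto simp: P_def T(2) intro!: prod_nonneg)
    finally have "real (card {n \<in> {1..N}. \<forall>i. frac (x n $ i) \<in> B i}) / real N \<le> (\<Sum>n\<in>{1..N}. P (x n)) / real N"
      by (rule divide_right_mono) simp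
    then show ?case using elim unfolding m_def by linarith
  qed
qed

text \<open>Frequencies and expected limits both have total 1, so an upper bound for all the other
  classes is a lower bound for the class \<open>s\<close>; the errors add up to at most
  \<open>card S\<close> times the individual one.\<close>

lemma frequencies_tendsto:
  fixes D :: "'s \<Rightarrow> nat \<Rightarrow> real"
  assumes "finite S" "s \<in> S"
    and tot: "\<forall>\<^sub>F N in sequentially. (\<Sum>s\<in>S. D s N) = 1" and "(\<Sum>s\<in>S. v s) = 1"
    and upper: "\<And>s \<epsilon>. s \<in> S \<Longrightarrow> 0 < \<epsilon> \<Longrightarrow> \<forall>\<^sub>F N in sequentially. D s N \<le> v s + \<epsilon>"
  shows "D s \<longlonglongrightarrow> v s"
proof (rule tendstoI)
  fix e :: real assume "0 < e"
  define \<epsilon> where "\<epsilon> = e / (2 * real (card S))"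
  have card: "0 < real (card S)" using assms(1,2) by (auto simp: card_gt_0_iff)
  then have "0 < \<epsilon>" using \<open>0 < e\<close> by (simp add: \<epsilon>_def)
  then have "\<forall>\<^sub>F N in sequentially. \<forall>s\<in>S. D s N \<le> v s + \<epsilon>"
    using upper \<open>finite S\<close> by (simp add: eventually_ball_finite)
  with tot show "\<forall>\<^sub>F N in sequentially. dist (D s N) (v s) < e"
  proof eventually_elim
    case (elim N)
    have "(\<Sum>t\<in>S - {s}. D t N) \<le> (\<Sum>t\<in>S - {s}. v t + \<epsilon>)" using elim by (intro sum_mono) auto
    also have "\<dots> = (\<Sum>t\<in>S - {s}. v t) + real (card (S - {s})) * \<epsilon>" by (simp add: sum.distrib)
    also have "\<dots> \<le> (\<Sum>t\<in>S - {s}. v t) + real (card S) * \<epsilon>"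
      using \<open>finite S\<close> \<open>0 < \<epsilon>\<close> by (intro add_left_mono mult_right_mono) (auto intro: card_mono)
    also have "real (card S) * \<epsilon> = e / 2" using card by (simp add: \<epsilon>_def)
    finally have "v s - e / 2 \<le> D s N"
      using elim(1) assms(4) sum.remove[OF assms(1,2), of "\<lambda>s. D s N"] sum.remove[OF assms(1,2), of v] by linarith
    moreover have "\<epsilon> \<le> e / 2" unfolding \<epsilon>_def using \<open>0 < e\<close> card by (intro frac_le) auto
    moreover have "D s N \<le> v s + \<epsilon>" using elim(2) assms(2) by blast
    ultimately show ?case using \<open>0 < e\<close> by (simp add: dist_real_def abs_if)
  qed
qed

lemma prod_Basis_cart: "(\<Prod>b\<in>Basis. f b) = (\<Prod>i\<in>UNIV. f (axis i 1 :: real ^ 'k))"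
proof -
  have B: "Basis = (\<lambda>i. axis i 1 :: real ^ 'k) ` UNIV" by (auto simp: Basis_vec_def)
  have "inj (\<lambda>i. axis i 1 :: real ^ 'k)" by (auto simp: inj_on_def axis_eq_axis)
  then show ?thesis unfolding B by (subst prod.reindex) (auto simp: o_def)
qed

text \<open>The indicator factors over the standard basis, whose inner products are the coordinates,
  so the integral is a product of one-dimensional ones.\<close>

lemma measure_lborel_product_set:
  fixes I :: "'k::finite \<Rightarrow> real set"
  assumes [measurable]: "\<And>i. I i \<in> sets borel" and fin: "\<And>i. emeasure lborel (I i) < \<infinity>"
  shows "measure lborel {y :: real ^ 'k. \<forall>i. y $ i \<in> I i} = (\<Prod>i\<in>UNIV. measure lborel (I i))"
proof -
  define S where "S = {y :: real ^ 'k. \<forall>i. y $ i \<in> I i}"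
  have [measurable]: "S \<in> sets borel"
  proof -
    have "S = (\<Inter>i. (\<lambda>y. y $ i) -` I i \<inter> space borel)" by (auto simp: S_def)
    also have "\<dots> \<in> sets borel"
    proof (intro sets.countable_INT'')
      fix i
      have "(\<lambda>y :: real ^ 'k. y $ i) \<in> borel_measurable borel"
        by (intro borel_measurable_continuous_onI continuous_intros)
      then show "(\<lambda>y :: real ^ 'k. y $ i) -` I i \<inter> space borel \<in> sets borel" by (rule measurable_sets) simp
    qed auto
    finally show ?thesis .
  qed
  have ind: "indicator S y = (\<Prod>b\<in>Basis. indicator (I (axis_index b)) (y \<bullet> b) :: ennreal)" for y
  proof -
    have "(\<Prod>b\<in>Basis. indicator (I (axis_index b)) (y \<bullet> b) :: ennreal) = (\<Prod>i\<in>UNIV. indicator (I i) (y $ i))"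
      by (simp add: prod_Basis_cart cart_eq_inner_axis axis_index_axis)
    then show ?thesis by (auto simp: S_def indicator_def of_bool_def)
  qed
  have "emeasure lborel S = (\<integral>\<^sup>+y. indicator S y \<partial>lborel)" by simp
  also have "\<dots> = (\<Prod>b\<in>Basis. \<integral>\<^sup>+x. indicator (I (axis_index (b :: real ^ 'k))) x \<partial>lborel)"
    unfolding ind by (rule nn_integral_lborel_prod) auto
  also have "\<dots> = (\<Prod>i\<in>UNIV. emeasure lborel (I i))" by (simp add: prod_Basis_cart axis_index_axis)
  also have "\<dots> = (\<Prod>i\<in>UNIV. ennreal (measure lborel (I i)))"
    using fin by (intro prod.cong refl emeasure_eq_ennreal_measure) (simp add: less_top)
  also have "\<dots> = ennreal (\<Prod>i\<in>UNIV. measure lborel (I i))" by (simp add: prod_ennreal)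
  finally show ?thesis unfolding S_def[symmetric] by (simp add: measure_def prod_nonneg)
qed

text \<open>Cutting each coordinate into \<open>I i\<close> and its complement partitions the cube
  into finitely many boxes. Their upper bounds involve closures; since all frontiers are null, these
  have the measures of the sets themselves and the bounds total 1, which makes every one of them a
  limit.\<close>

theorem Weyl_criterion:
  fixes x :: "nat \<Rightarrow> real ^ 'k"
  assumes weyl: "\<And>h :: 'k \<Rightarrow> int. \<exists>i. h i \<noteq> (0::int) \<Longrightarrow>
      (\<lambda>N. (\<Sum>n\<in>{1..N}. cis (2 * pi * (\<Sum>i\<in>UNIV. h i * x n $ i))) / N) \<longlonglongrightarrow> 0"
  shows "uniformly_distributed_mod1 x"
  unfolding uniformly_distributed_mod1_def
proof (intro allI impI)
  fix I :: "'k \<Rightarrow> real set"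
  assume I: "\<forall>i. is_interval (I i) \<and> I i \<subseteq> {0..1}"
  \<comment> \<open>The complement of an interval need not be an interval; only boundedness and a
    null frontier are used below.\<close>
  define B where "B i b = (if b then I i else {0..1} - I i)" for i b
  have B: "B i b \<subseteq> {0..1}" for i b using I by (auto simp: B_def)
  have bdd: "bounded (B i b)" for i b using bounded_subset[OF bounded_closed_interval B] .
  have "negligible (frontier (I i))" for i
    using I by (simp add: negligible_convex_frontier is_interval_convex)
  moreover have "frontier ({0..1} - I i) \<subseteq> frontier {0..1} \<union> frontier (I i)" for i
    using frontier_Int_subset[of "{0..1}" "- I i"] by (simp add: Diff_eq)
  moreover have "negligible (frontier {0..1::real})" by (simp add: negligible_convex_frontier)
  ultimately have "negligible (frontier ({0..1} - I i))" "negligible (frontier (I i))" for i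
    by (blast intro: negligible_subset negligible_Un)+
  then have front: "negligible (frontier (B i b))" for i b unfolding B_def by auto
  have lm: "B i b \<in> lmeasurable" for i b using measurable_Jordan[OF bdd front] .
  have mcl: "measure lebesgue (closure (B i b)) = measure lebesgue (B i b)" for i b
    using measure_closure[OF bdd front] .
  have "measure lebesgue (B i False) = 1 - measure lebesgue (B i True)" for i
    using measurable_measure_Diff[of "{0..1::real}" lebesgue "I i"] lm[of i True] I
    by (simp add: B_def fmeasurableD)
  then have msum: "(\<Sum>b\<in>UNIV. measure lebesgue (B i b)) = 1" for i by (simp add: UNIV_bool)
  define D where "D s N = real (card {n \<in> {1..N}. \<forall>i. frac (x n $ i) \<in> B i (s i)}) / real N" for s :: "'k \<Rightarrow> bool" and N
  define v where "v s = (\<Prod>i\<in>UNIV. measure lebesgue (B i (s i)))" for s :: "'k \<Rightarrow> bool"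
  have "D (\<lambda>_. True) \<longlonglongrightarrow> v (\<lambda>_. True)"
  proof (rule frequencies_tendsto[of UNIV "\<lambda>_. True" D v])
    show "\<forall>\<^sub>F N in sequentially. (\<Sum>s\<in>UNIV. D s N) = 1"
      using eventually_gt_at_top[of 0]
    proof eventually_elim
      case (elim N)
      have "{1..N} = (\<Union>s\<in>UNIV. {n \<in> {1..N}. \<forall>i. frac (x n $ i) \<in> B i (s i)})"
      proof -
        have "\<exists>s. \<forall>i. frac (x n $ i) \<in> B i (s i)" for n
          by (rule exI[of _ "\<lambda>i. frac (x n $ i) \<in> I i"]) (auto simp: B_def frac_ge_0 less_imp_le[OF frac_lt_1])
        then show ?thesis by auto
      qed
      then have "N = card (\<Union>s\<in>UNIV. {n \<in> {1..N}. \<forall>i. frac (x n $ i) \<in> B i (s i)})" by (metis card_atLeastAtMost diff_Suc_1)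
      also have "\<dots> = (\<Sum>s\<in>UNIV. card {n \<in> {1..N}. \<forall>i. frac (x n $ i) \<in> B i (s i)})"
      proof (rule card_UN_disjoint)
        show "\<forall>s\<in>UNIV. \<forall>t\<in>UNIV. s \<noteq> t \<longrightarrow> {n \<in> {1..N}. \<forall>i. frac (x n $ i) \<in> B i (s i)} \<inter> {n \<in> {1..N}. \<forall>i. frac (x n $ i) \<in> B i (t i)} = {}"
        proof (intro ballI impI)
          fix s t :: "'k \<Rightarrow> bool" assume "s \<noteq> t"
          then obtain i where "s i \<noteq> t i" by auto
          then have "B i (s i) \<inter> B i (t i) = {}" by (auto simp: B_def)
          then show "{n \<in> {1..N}. \<forall>i. frac (x n $ i) \<in> B i (s i)} \<inter> {n \<in> {1..N}. \<forall>i. frac (x n $ i) \<in> B i (t i)} = {}" by auto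
        qed
      qed auto
      finally show ?case using elim unfolding D_def sum_divide_distrib[symmetric] of_nat_sum[symmetric] by simp
    qed
    show "(\<Sum>s\<in>UNIV. v s) = 1"
      using prod_sum_PiE[of "UNIV :: 'k set" "\<lambda>_. UNIV :: bool set" "\<lambda>i b. measure lebesgue (B i b)"]
      by (simp add: v_def msum PiE_UNIV_domain)
    show "\<forall>\<^sub>F N in sequentially. D s N \<le> v s + \<epsilon>" if "0 < \<epsilon>" for s \<epsilon>
      using box_frequency_upper[of x "\<lambda>i. B i (s i)" \<epsilon>, OF weyl B that] unfolding D_def v_def mcl .
  qed auto
  moreover have "v (\<lambda>_. True) = measure lborel {y :: real ^ 'k. \<forall>i. y $ i \<in> I i}"
  proof -
    have borel: "I i \<in> sets borel" for i using I by (simp add: real_interval_borel_measurable)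
    have "emeasure lborel (I i) < \<infinity>" for i
      using I by (intro emeasure_bounded_finite bounded_subset[OF bounded_closed_interval]) auto
    then show ?thesis using borel by (simp add: measure_lborel_product_set v_def B_def)
  qed
  moreover have "D (\<lambda>_. True) = (\<lambda>N. real (card {n \<in> {1..N}. \<forall>i. frac (x n $ i) \<in> I i}) / real N)"
    by (simp add: fun_eq_iff D_def B_def)
  ultimately show "(\<lambda>N. real (card {n \<in> {1..N}. \<forall>i. frac (x n $ i) \<in> I i}) / real N)
      \<longlonglongrightarrow> measure lborel {y :: real ^ 'k. \<forall>i. y $ i \<in> I i}"
    by simp
qed

section \<open>Hausdorff null sets\<close>

lemma hausdorff1_pre_mono: "A \<subseteq> B \<Longrightarrow> hausdorff1_pre \<eta> A \<le> hausdorff1_pre \<eta> B"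
  unfolding hausdorff1_pre_def by (intro Inf_superset_mono) blast

lemma hausdorff1_mono: "A \<subseteq> B \<Longrightarrow> hausdorff1 A \<le> hausdorff1 B"
  unfolding hausdorff1_def by (intro SUP_mono') (rule hausdorff1_pre_mono)

lemma hausdorff1_eq_0_iff: "hausdorff1 A = 0 \<longleftrightarrow> (\<forall>\<eta>>0. hausdorff1_pre \<eta> A = 0)"
  unfolding hausdorff1_def bot_ennreal[symmetric] SUP_bot_conv by auto

text \<open>The \<open>n\<close>-th set receives the budget \<open>e * (1/2) ^ Suc n\<close>; the
  resulting double sequence of covering sets is enumerated by \<open>prod_decode\<close>.\<close>

lemma hausdorff1_null_UN:
  fixes A :: "nat \<Rightarrow> 'b::metric_space set"
  assumes "\<And>n. hausdorff1 (A n) = 0"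
  shows "hausdorff1 (\<Union>n. A n) = 0"
  unfolding hausdorff1_eq_0_iff
proof (intro allI impI)
  fix \<eta> :: real assume "0 < \<eta>"
  have "hausdorff1_pre \<eta> (\<Union>n. A n) \<le> ennreal e" if "0 < e" for e
  proof -
    have "\<exists>U. (\<Sum>k. ennreal (diameter (U k))) < ennreal (e * (1/2) ^ Suc n) \<and>
        A n \<subseteq> (\<Union>k. U k) \<and> (\<forall>k. bounded (U k) \<and> diameter (U k) \<le> \<eta>)" for n
    proof -
      have "hausdorff1_pre \<eta> (A n) < ennreal (e * (1/2) ^ Suc n)"
        using assms[of n] \<open>0 < \<eta>\<close> that unfolding hausdorff1_eq_0_iff by simp
      then show ?thesis unfolding hausdorff1_pre_def Inf_less_iff by blast
    qed
    then obtain U where U: "\<And>n. (\<Sum>k. ennreal (diameter (U n k))) < ennreal (e * (1/2) ^ Suc n)"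
        "\<And>n. A n \<subseteq> (\<Union>k. U n k)" "\<And>n k. bounded (U n k)" "\<And>n k. diameter (U n k) \<le> \<eta>"
      by metis
    define V where "V i = (case prod_decode i of (n, k) \<Rightarrow> U n k)" for i
    have "(\<Sum>i. ennreal (diameter (V i))) = (\<Sum>n. \<Sum>k. ennreal (diameter (U n k)))"
      using suminf_ennreal_2dimen[of "\<lambda>n. \<Sum>k. ennreal (diameter (U n k))" "\<lambda>(n, k). ennreal (diameter (U n k))"]
      by (simp add: V_def case_prod_beta)
    also have "\<dots> \<le> (\<Sum>n. ennreal (e * (1/2) ^ Suc n))"
      using U(1) by (intro suminf_le) (auto simp: less_imp_le)
    also have "\<dots> = ennreal (\<Sum>n. e * (1/2) ^ Suc n)"
      using that power_half_series by (intro suminf_ennreal2) (auto simp: sums_iff intro!: summable_mult)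
    also have "(\<Sum>n. e * (1/2) ^ Suc n) = e"
      using sums_mult[OF power_half_series, of e] by (simp add: sums_iff)
    finally have le: "(\<Sum>i. ennreal (diameter (V i))) \<le> ennreal e" .
    have "(\<Union>n. A n) \<subseteq> (\<Union>i. V i)"
    proof
      fix x assume "x \<in> (\<Union>n. A n)"
      then obtain n k where "x \<in> U n k" using U(2) by blast
      then have "x \<in> V (prod_encode (n, k))" by (simp add: V_def)
      then show "x \<in> (\<Union>i. V i)" by blast
    qed
    moreover have "bounded (V i) \<and> diameter (V i) \<le> \<eta>" for i
      using U(3,4) by (simp add: V_def case_prod_beta)
    ultimately have "hausdorff1_pre \<eta> (\<Union>n. A n) \<le> (\<Sum>i. ennreal (diameter (V i)))"
      unfolding hausdorff1_pre_def by (intro Inf_lower) blast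
    then show ?thesis using le by (rule order_trans)
  qed
  then show "hausdorff1_pre \<eta> (\<Union>n. A n) = 0"
    by (metis ennreal_le_epsilon add_0 le_zero_eq)
qed

text \<open>Non-overlapping short intervals inside an open set of measure below \<open>e / L\<close>
  cover \<open>S\<close>. Their images have diameters at most \<open>L\<close> times the lengths, so
  the total is at most \<open>e\<close>.\<close>

lemma hausdorff1_Lipschitz_image_negligible:
  fixes f :: "real \<Rightarrow> 'b::real_normed_vector"
  assumes "negligible S" "S \<subseteq> {a..b}" "a < b" "0 < L"
    and lip: "\<And>x y. x \<in> {a..b} \<Longrightarrow> y \<in> {a..b} \<Longrightarrow> norm (f x - f y) \<le> L * \<bar>x - y\<bar>"
  shows "hausdorff1 (f ` S) = 0"
  unfolding hausdorff1_eq_0_iff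
proof (intro allI impI)
  fix \<eta> :: real assume "0 < \<eta>"
  have "hausdorff1_pre \<eta> (f ` S) \<le> ennreal e" if "0 < e" for e
  proof -
    have "S \<in> sets lebesgue" using \<open>negligible S\<close> by (simp add: negligible_imp_sets)
    then obtain T where T: "open T" "S \<subseteq> T" "emeasure lebesgue (T - S) < ennreal (e / L)"
      using sets_lebesgue_outer_open[of S "e / L"] \<open>0 < e\<close> \<open>0 < L\<close> by (metis divide_pos_pos)
    have "emeasure lebesgue (T - S) = emeasure lebesgue T"
      using T(1) \<open>negligible S\<close> by (intro emeasure_Diff_null_set) (auto simp: negligible_iff_null_sets)
    then have mT: "emeasure lborel T < ennreal (e / L)" using T by simp
    \<comment> \<open>The first set keeps an interval inside \<open>T\<close> and its image below
      diameter \<open>\<eta>\<close>. The second only makes \<open>g\<close> a gauge at points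
      outside \<open>T\<close>; the tags lie in \<open>S\<close> and hence in
      \<open>T\<close>.\<close>
    define g where "g x = T \<inter> ball x (\<eta> / (2 * L)) \<union> (if x \<in> T then {} else ball x 1)" for x
    have "gauge g" unfolding gauge_def g_def using T(1) \<open>0 < \<eta>\<close> \<open>0 < L\<close> by auto
    moreover have "S \<subseteq> cbox a b" "box a b \<noteq> {}" using assms by auto
    ultimately obtain \<D> where \<D>: "countable \<D>" "\<Union>\<D> \<subseteq> cbox a b"
      "\<And>K. K \<in> \<D> \<Longrightarrow> interior K \<noteq> {} \<and> (\<exists>c d. K = cbox c d)"
      "pairwise (\<lambda>A B. interior A \<inter> interior B = {}) \<D>"
      "\<And>K. K \<in> \<D> \<Longrightarrow> \<exists>x \<in> S \<inter> K. K \<subseteq> g x" "S \<subseteq> \<Union>\<D>"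
      using covering_lemma[of S a b g] by metis
    \<comment> \<open>\<open>\<D>\<close> may be finite, so its enumeration is padded with empty
      sets, whose images have diameter 0.\<close>
    define idx where "idx = to_nat_on \<D> ` \<D>"
    define K where "K n = (if n \<in> idx then from_nat_into \<D> n else {})" for n
    have K: "K n \<in> \<D>" if "n \<in> idx" for n using that \<D>(1) unfolding K_def idx_def by auto
    have UK: "(\<Union>n. K n) = \<Union>\<D>"
    proof
      show "(\<Union>n. K n) \<subseteq> \<Union>\<D>" using K unfolding K_def by (auto split: if_splits)
      show "\<Union>\<D> \<subseteq> (\<Union>n. K n)"
      proof
        fix x assume "x \<in> \<Union>\<D>"
        then obtain C where "C \<in> \<D>" "x \<in> C" by blast
        then have "x \<in> K (to_nat_on \<D> C)" using \<D>(1) by (simp add: K_def idx_def)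
        then show "x \<in> (\<Union>n. K n)" by blast
      qed
    qed
    have disj: "disjoint_family (\<lambda>n. interior (K n))"
      unfolding disjoint_family_on_def
    proof (intro ballI impI)
      fix m n :: nat assume "m \<noteq> n"
      show "interior (K m) \<inter> interior (K n) = {}"
      proof (cases "m \<in> idx \<and> n \<in> idx")
        case True
        then have "K m \<noteq> K n" using \<open>m \<noteq> n\<close> \<D>(1) unfolding K_def idx_def by auto
        then show ?thesis using \<D>(4) K True by (simp add: pairwise_def)
      qed (auto simp: K_def)
    qed
    have *: "diameter (f ` K n) \<le> \<eta> \<and> bounded (f ` K n) \<and>
        ennreal (diameter (f ` K n)) \<le> ennreal L * emeasure lborel (interior (K n)) \<and> interior (K n) \<subseteq> T" for n
    proof (cases "n \<in> idx")
      case False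
      then show ?thesis
        using \<open>0 < \<eta>\<close> by (simp add: K_def)
    next
      case True
      obtain c d where cd: "K n = {c..d}" "interior (K n) \<noteq> {}" using \<D>(3)[OF K[OF True]] by auto
      then have "c < d" by (auto simp: interior_atLeastAtMost_real)
      obtain x where x: "x \<in> S" "K n \<subseteq> g x" using \<D>(5)[OF K[OF True]] by blast
      have "x \<in> T" using x(1) T(2) by blast
      with x(2) have sub: "K n \<subseteq> T" "K n \<subseteq> ball x (\<eta> / (2 * L))" unfolding g_def by auto
      have Kab: "K n \<subseteq> {a..b}" using \<D>(2) K[OF True] by auto
      have "c \<in> K n" "d \<in> K n" using cd \<open>c < d\<close> by auto
      then have "c \<in> ball x (\<eta> / (2 * L))" "d \<in> ball x (\<eta> / (2 * L))" using sub(2) by blast+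
      then have "d - c < 2 * (\<eta> / (2 * L))" by (auto simp: dist_real_def abs_if split: if_splits)
      then have small: "L * (d - c) \<le> \<eta>" using \<open>0 < L\<close> by (simp add: field_simps)
      have n: "norm (f s - f t) \<le> L * (d - c)" if "s \<in> K n" "t \<in> K n" for s t
      proof -
        have "norm (f s - f t) \<le> L * \<bar>s - t\<bar>" using lip Kab that by blast
        also have "\<dots> \<le> L * (d - c)" using that cd \<open>0 < L\<close> by (intro mult_left_mono) auto
        finally show ?thesis .
      qed
      have "diameter (f ` K n) \<le> L * (d - c)"
        using n \<open>c < d\<close> \<open>0 < L\<close> by (intro diameter_le) auto
      moreover have "bounded (f ` K n)"
        using n unfolding bounded_two_points dist_norm by blast
      moreover have "ennreal L * emeasure lborel (interior (K n)) = ennreal (L * (d - c))"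
        using cd \<open>c < d\<close> \<open>0 < L\<close> by (simp add: interior_atLeastAtMost_real ennreal_mult)
      ultimately show ?thesis
        using small sub(1) interior_subset[of "K n"] by (auto intro: ennreal_leI)
    qed
    note diam = *[THEN conjunct1] *[THEN conjunct2, THEN conjunct1]
      *[THEN conjunct2, THEN conjunct2, THEN conjunct1] *[THEN conjunct2, THEN conjunct2, THEN conjunct2]
    have "hausdorff1_pre \<eta> (f ` S) \<le> (\<Sum>n. ennreal (diameter (f ` K n)))"
      unfolding hausdorff1_pre_def
    proof (rule Inf_lower, intro CollectI exI[of _ "\<lambda>n. f ` K n"] conjI allI refl diam)
      show "f ` S \<subseteq> (\<Union>n. f ` K n)" using \<D>(6) UK by blast
    qed
    also have "\<dots> \<le> (\<Sum>n. ennreal L * emeasure lborel (interior (K n)))"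
      by (intro suminf_le diam) auto
    \<comment> \<open>Lengths are taken as measures of interiors because the intervals may share end
      points.\<close>
    also have "\<dots> = ennreal L * emeasure lborel (\<Union>n. interior (K n))"
      using disj by (subst suminf_emeasure[symmetric]) auto
    also have "\<dots> \<le> ennreal L * ennreal (e / L)"
    proof (rule mult_left_mono)
      have "emeasure lborel (\<Union>n. interior (K n)) \<le> emeasure lborel T"
        using diam(4) T(1) by (intro emeasure_mono) auto
      then show "emeasure lborel (\<Union>n. interior (K n)) \<le> ennreal (e / L)" using mT by simp
    qed simp
    also have "\<dots> = ennreal e" using \<open>0 < L\<close> \<open>0 < e\<close> by (simp flip: ennreal_mult)
    finally show ?thesis .
  qed
  then show "hausdorff1_pre \<eta> (f ` S) = 0"
    by (metis ennreal_le_epsilon add_0 le_zero_eq)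
qed

section \<open>Null sets of parameters have null images on the curve\<close>

lemma real_analytic_Lipschitz_on:
  fixes f :: "real \<Rightarrow> real ^ 'k"
  assumes "real_analytic f"
  obtains L where "0 < L" "\<And>x y. x \<in> {a..b} \<Longrightarrow> y \<in> {a..b} \<Longrightarrow> norm (f x - f y) \<le> L * \<bar>x - y\<bar>"
proof -
  have "\<exists>L>0. \<forall>x\<in>{a..b}. \<forall>y\<in>{a..b}. \<bar>f x $ i - f y $ i\<bar> \<le> L * \<bar>x - y\<bar>" for i
  proof -
    define g where "g t = f t $ i" for t
    have g: "real_analytic g" unfolding g_def using real_analytic_bounded_linear[OF assms bounded_linear_vec_nth] .
    have D: "(g has_real_derivative deriv g t) (at t)" for t
      using real_analytic_higher_deriv[OF g, of 0 t] by simp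
    have "continuous_on {a..b} (deriv g)"
      using real_analytic_higher_deriv[OF g, of 1] by (auto intro!: continuous_at_imp_continuous_on DERIV_isCont)
    then have "bounded (deriv g ` {a..b})" by (intro compact_imp_bounded compact_continuous_image) auto
    then obtain L where L: "0 < L" "\<And>t. t \<in> {a..b} \<Longrightarrow> norm (deriv g t) \<le> L" by (metis bounded_pos imageI)
    have "norm (g x - g y) \<le> L * norm (x - y)" if "x \<in> {a..b}" "y \<in> {a..b}" for x y
      by (rule field_differentiable_bound[OF _ has_field_derivative_at_within[OF D] L(2) that]) auto
    then show ?thesis using L(1) unfolding g_def by auto
  qed
  then obtain L where L: "\<And>i. 0 < L i"
    "\<And>i x y. x \<in> {a..b} \<Longrightarrow> y \<in> {a..b} \<Longrightarrow> \<bar>f x $ i - f y $ i\<bar> \<le> L i * \<bar>x - y\<bar>" by metis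
  show thesis
  proof (rule that[of "\<Sum>i\<in>UNIV. L i"])
    show "0 < (\<Sum>i\<in>UNIV. L i)" using L(1) by (intro sum_pos) auto
    fix x y assume "x \<in> {a..b}" "y \<in> {a..b}"
    then have "(\<Sum>i\<in>UNIV. \<bar>(f x - f y) $ i\<bar>) \<le> (\<Sum>i\<in>UNIV. L i * \<bar>x - y\<bar>)"
      using L(2) by (intro sum_mono) auto
    then show "norm (f x - f y) \<le> (\<Sum>i\<in>UNIV. L i) * \<bar>x - y\<bar>"
      using norm_le_l1_cart[of "f x - f y"] by (simp add: sum_distrib_right)
  qed
qed

lemma hausdorff1_analytic_image_negligible:
  fixes f :: "real \<Rightarrow> real ^ 'k"
  assumes "real_analytic f" "negligible S"
  shows "hausdorff1 (f ` S) = 0"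
proof -
  \<comment> \<open>The curve is Lipschitz only on compact intervals, so the line is exhausted by
    them; \<open>Suc n\<close> keeps each one non-degenerate.\<close>
  have "hausdorff1 (f ` (S \<inter> {- real (Suc n)..real (Suc n)})) = 0" for n
  proof -
    obtain L where "0 < L" "\<And>x y. x \<in> {- real (Suc n)..real (Suc n)} \<Longrightarrow> y \<in> {- real (Suc n)..real (Suc n)} \<Longrightarrow>
        norm (f x - f y) \<le> L * \<bar>x - y\<bar>"
      using real_analytic_Lipschitz_on[OF assms(1)] by blast
    then show ?thesis
      by (intro hausdorff1_Lipschitz_image_negligible[of _ "- real (Suc n)" "real (Suc n)" L])
         (use assms(2) in \<open>auto intro: negligible_subset\<close>)
  qed
  then have "hausdorff1 (\<Union>n. f ` (S \<inter> {- real (Suc n)..real (Suc n)})) = 0" by (rule hausdorff1_null_UN)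
  moreover have sub: "f ` S \<subseteq> (\<Union>n. f ` (S \<inter> {- real (Suc n)..real (Suc n)}))"
  proof
    fix y assume "y \<in> f ` S"
    then obtain t where t: "t \<in> S" "y = f t" by blast
    obtain n where "\<bar>t\<bar> < real n" using reals_Archimedean2 by blast
    then have "t \<in> {- real (Suc n)..real (Suc n)}" by auto
    then show "y \<in> (\<Union>n. f ` (S \<inter> {- real (Suc n)..real (Suc n)}))" using t by blast
  qed
  ultimately show ?thesis using hausdorff1_mono[OF sub] by simp
qed

section \<open>Scattered sequences along analytic curves\<close>

text \<open>Links the full double sum from squaring a Weyl sum to the sum over \<open>m < n\<close>
  in the definition of \<open>delta_scattered\<close>.\<close>

lemma sum_square_symmetric:
  fixes k :: "nat \<Rightarrow> nat \<Rightarrow> real"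
  assumes "\<And>m n. k m n = k n m"
  shows "(\<Sum>n\<in>{1..N}. \<Sum>m\<in>{1..N}. k n m) = (\<Sum>n\<in>{1..N}. k n n) + 2 * (\<Sum>n\<in>{1..N}. \<Sum>m\<in>{1..<n}. k n m)"
proof (induction N)
  case (Suc N)
  have "{1..<Suc N} = {1..N}" by auto
  moreover have "(\<Sum>n\<in>{1..N}. k n (Suc N)) = (\<Sum>n\<in>{1..N}. k (Suc N) n)"
    by (intro sum.cong refl assms)
  ultimately show ?case using Suc by (simp add: sum.distrib)
qed simp

text \<open>The truncated kernel decreases in the distance, so stretching by
  \<open>\<bar>c\<bar> \<ge> 1\<close> keeps the same \<open>\<epsilon>\<close>. The case in view is
  a non-zero integer \<open>c\<close>.\<close>

lemma scattered_mult:
  assumes "scattered a" "1 \<le> \<bar>c\<bar>"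
  shows "scattered (\<lambda>n. c * a n)"
  unfolding scattered_def
proof
  fix \<delta> :: real assume \<delta>: "\<delta> \<in> {0<..1}"
  then obtain \<epsilon> where \<epsilon>: "0 < \<epsilon>" "\<forall>\<^sub>F N in sequentially. 1 / (real N)\<^sup>2 *
      (\<Sum>n\<in>{1..N}. \<Sum>m\<in>{1..<n}. (if a n = a m then 1 else min (\<bar>a n - a m\<bar> powr (- \<delta>)) 1))
      \<le> 1 / (ln (real N)) powr (1 + \<epsilon>)"
    using assms(1) unfolding scattered_def delta_scattered_def by blast
  have le: "(if c * a n = c * a m then 1 else min (\<bar>c * a n - c * a m\<bar> powr (- \<delta>)) 1)
      \<le> (if a n = a m then 1 else min (\<bar>a n - a m\<bar> powr (- \<delta>)) 1)" for n m
  proof -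
    have "c \<noteq> 0" using assms(2) by auto
    have "\<bar>c * a n - c * a m\<bar> powr (- \<delta>) \<le> \<bar>a n - a m\<bar> powr (- \<delta>)" if "a n \<noteq> a m"
    proof -
      have "1 * \<bar>a n - a m\<bar> \<le> \<bar>c\<bar> * \<bar>a n - a m\<bar>" using assms(2) by (intro mult_right_mono) auto
      also have "\<dots> = \<bar>c * a n - c * a m\<bar>" by (simp add: abs_mult[symmetric] algebra_simps)
      finally show ?thesis using that \<delta> by (intro powr_mono2') auto
    qed
    then show ?thesis using \<open>c \<noteq> 0\<close> by (auto simp: min_le_iff_disj)
  qed
  have "1 / (real N)\<^sup>2 * (\<Sum>n\<in>{1..N}. \<Sum>m\<in>{1..<n}.
        (if c * a n = c * a m then 1 else min (\<bar>c * a n - c * a m\<bar> powr (- \<delta>)) 1))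
      \<le> 1 / (real N)\<^sup>2 * (\<Sum>n\<in>{1..N}. \<Sum>m\<in>{1..<n}.
        (if a n = a m then 1 else min (\<bar>a n - a m\<bar> powr (- \<delta>)) 1))" for N :: nat
    by (intro mult_left_mono sum_mono le) auto
  then show "delta_scattered \<delta> (\<lambda>n. c * a n)"
    unfolding delta_scattered_def using \<epsilon> by (intro exI[of _ \<epsilon>] conjI eventually_mono[OF \<epsilon>(2)]) (auto intro: order_trans)
qed

lemma AE_imp_negligible:
  assumes "AE t in lborel. P t"
  shows "negligible {t :: real. \<not> P t}"
proof -
  obtain N where "N \<in> null_sets lborel" "{t. \<not> P t} \<subseteq> N"
    using assms unfolding eventually_ae_filter by auto
  then show ?thesis
    by (meson negligible_iff_null_sets negligible_subset null_sets_completionI)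
qed

text \<open>
  Only the component of a frequency orthogonal to the directions along which \<open>f\<close> is constant
  produces cancellation; \<open>u\<close> is a unit vector of that complement which detects enough of it.
\<close>

lemma pair_correlation_bound:
  fixes f :: "real \<Rightarrow> real ^ 'k" and u :: "real ^ 'k"
  assumes f: "real_analytic f" and u: "norm u = 1"
    and orth: "\<And>y. (\<And>t. y \<bullet> f t = y \<bullet> f t\<^sub>0) \<Longrightarrow> u \<bullet> y = 0"
  obtains p q C \<delta> where "p < t\<^sub>0" "t\<^sub>0 < q" "0 < \<delta>" "\<delta> \<le> 1" "0 \<le> C"
    "\<And>y. norm (integral {p..q} (\<lambda>t. cis (2 * pi * (y \<bullet> f t))))
      \<le> C * (if u \<bullet> y = 0 then 1 else min (\<bar>u \<bullet> y\<bar> powr (- \<delta>)) 1)"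
proof -
  define V where "V = {y. \<forall>t. y \<bullet> f t = y \<bullet> f t\<^sub>0}"
  have V: "subspace V" unfolding V_def subspace_def by (simp add: inner_add_left) metis
  \<comment> \<open>The unit sphere of the orthogonal complement of \<open>V\<close>: compact, and
    free of directions along which \<open>f\<close> is constant.\<close>
  define S where "S = {z. norm z = 1 \<and> (\<forall>y\<in>V. y \<bullet> z = 0)}"
  have "compact S"
  proof -
    have "S = sphere 0 1 \<inter> (\<Inter>y\<in>V. {z. y \<bullet> z = 0})" by (auto simp: S_def)
    moreover have "closed (\<Inter>y\<in>V. {z. y \<bullet> z = 0})" by (intro closed_INT ballI closed_hyperplane)
    ultimately show ?thesis by (simp add: compact_Int_closed)
  qed
  moreover have "\<exists>t. z \<bullet> f t \<noteq> z \<bullet> f t\<^sub>0" if "z \<in> S" for z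
  proof (rule ccontr)
    assume "\<not> ?thesis"
    then have "z \<in> V" by (simp add: V_def)
    then show False using that by (auto simp: S_def)
  qed
  ultimately obtain p q K \<delta> where pq: "p < t\<^sub>0" "t\<^sub>0 < q" "0 < \<delta>" "\<delta> \<le> 1" "0 \<le> K"
    and K: "\<And>z \<Lambda>. z \<in> S \<Longrightarrow> 1 \<le> \<Lambda> \<Longrightarrow>
      norm (integral {p..q} (\<lambda>t. cis (\<Lambda> * (z \<bullet> f t)))) \<le> K * \<Lambda> powr (- \<delta>)"
    using local_oscillatory_bound[OF f, of S t\<^sub>0] by metis
  define C where "C = K + (q - p)"
  have "norm (integral {p..q} (\<lambda>t. cis (2 * pi * (y \<bullet> f t))))
      \<le> C * (if u \<bullet> y = 0 then 1 else min (\<bar>u \<bullet> y\<bar> powr (- \<delta>)) 1)" (is "norm ?I \<le> _") for y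
  proof (cases "\<bar>u \<bullet> y\<bar> \<le> 1")
    \<comment> \<open>The truncated kernel equals 1 here, including at
      \<open>u \<bullet> y = 0\<close>, so the length of the interval is a sufficient bound.\<close>
    case True
    have "continuous_on {p..q} (\<lambda>t. cis (2 * pi * (y \<bullet> f t)))" by (intro continuous_intros real_analytic_continuous_on f)
    then have "norm ?I \<le> 1 * (q - p)" using pq by (intro integral_bound) auto
    also have "\<dots> \<le> C" using pq by (simp add: C_def)
    finally have "norm ?I \<le> C" .
    moreover have "1 \<le> \<bar>u \<bullet> y\<bar> powr (- \<delta>)" if "u \<bullet> y \<noteq> 0"
      using True that pq powr_mono2'[of "- \<delta>" "\<bar>u \<bullet> y\<bar>" 1] by simp
    ultimately show ?thesis by (auto simp: min_def)
  next
    case False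
    \<comment> \<open>The component \<open>v\<close> contributes a constant phase of modulus 1.
      Since \<open>u\<close> is orthogonal to \<open>V\<close>,
      \<open>\<bar>u \<bullet> y\<bar>\<close> is at most \<open>norm z\<close>, so decay in the
      length of \<open>z\<close> implies decay in \<open>u \<bullet> y\<close>.\<close>
    obtain v z where vz: "v \<in> span V" "\<And>w. w \<in> span V \<Longrightarrow> orthogonal z w" "y = v + z"
      using orthogonal_subspace_decomp_exists[of V y] by metis
    have v: "v \<in> V" using vz(1) V by (simp add: span_eq_iff[THEN iffD2])
    have z: "w \<bullet> z = 0" if "w \<in> V" for w
      using vz(2)[of w] that by (simp add: span_base orthogonal_def inner_commute)
    have "u \<bullet> v = 0" using orth[of v] v by (auto simp: V_def)
    then have "u \<bullet> y = u \<bullet> z" by (simp add: vz(3) inner_add_right)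
    then have uz: "\<bar>u \<bullet> y\<bar> \<le> norm z" using Cauchy_Schwarz_ineq2[of u z] u by simp
    then have nz: "1 < norm z" using False by linarith
    define \<Lambda> where "\<Lambda> = 2 * pi * norm z"
    have "1 * norm z \<le> (2 * pi) * norm z" using pi_gt3 by (intro mult_right_mono) auto
    then have \<Lambda>: "norm z \<le> \<Lambda>" by (simp add: \<Lambda>_def)
    define e where "e = z /\<^sub>R norm z"
    have "z \<noteq> 0" using nz by auto
    then have "e \<in> S" unfolding S_def e_def using z by (auto simp: inner_scaleR_right)
    have "cis (2 * pi * (y \<bullet> f t)) = cis (2 * pi * (v \<bullet> f t\<^sub>0)) * cis (\<Lambda> * (e \<bullet> f t))" for t
    proof -
      have "v \<bullet> f t = v \<bullet> f t\<^sub>0" using v unfolding V_def by blast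
      moreover have "\<Lambda> * (e \<bullet> f t) = 2 * pi * (z \<bullet> f t)" using \<open>z \<noteq> 0\<close> by (simp add: \<Lambda>_def e_def)
      ultimately show ?thesis by (simp add: vz(3) inner_add_left cis_mult algebra_simps)
    qed
    then have "?I = cis (2 * pi * (v \<bullet> f t\<^sub>0)) * integral {p..q} (\<lambda>t. cis (\<Lambda> * (e \<bullet> f t)))"
      by (simp add: integral_mult_right)
    then have "norm ?I = norm (integral {p..q} (\<lambda>t. cis (\<Lambda> * (e \<bullet> f t))))" by (simp add: norm_mult)
    also have "\<dots> \<le> K * \<Lambda> powr (- \<delta>)" using K[OF \<open>e \<in> S\<close>] \<Lambda> nz by simp
    also have "\<dots> \<le> C * \<bar>u \<bullet> y\<bar> powr (- \<delta>)"
      using uz \<Lambda> False pq by (intro mult_mono powr_mono2') (auto simp: C_def)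
    moreover have "\<bar>u \<bullet> y\<bar> powr (- \<delta>) \<le> 1"
      using False pq powr_mono2'[of "- \<delta>" 1 "\<bar>u \<bullet> y\<bar>"] by simp
    ultimately show ?thesis using False by (auto simp: min_def)
  qed
  then show thesis using that[of p q \<delta> C] pq by (simp add: C_def)
qed

text \<open>Negligibility is a local property, so it suffices to treat a neighbourhood of each bad
  \<open>t\<^sub>0\<close>, with an exponent \<open>\<delta>\<close> that may depend on
  \<open>t\<^sub>0\<close>; scatteredness is then invoked for just that exponent.\<close>

lemma exponential_averages_negligible:
  fixes f :: "real \<Rightarrow> real ^ 'k" and w :: "nat \<Rightarrow> real ^ 'k"
  assumes f: "real_analytic f" and u: "norm u = 1"
    and orth: "\<And>y c. (\<And>t. y \<bullet> f t = c) \<Longrightarrow> u \<bullet> y = 0"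
    and scat: "scattered (\<lambda>n. u \<bullet> w n)"
  shows "negligible {t. \<not> (\<lambda>N. (\<Sum>n\<in>{1..N}. cis (2 * pi * (w n \<bullet> f t))) / N) \<longlonglongrightarrow> 0}"
    (is "negligible ?Bad")
proof (rule locally_negligible_alt[THEN iffD2], rule ballI)
  fix t\<^sub>0 assume "t\<^sub>0 \<in> ?Bad"
  obtain p q C \<delta> where pq: "p < t\<^sub>0" "t\<^sub>0 < q" "0 < \<delta>" "\<delta> \<le> 1" "0 \<le> C"
    and C: "\<And>y. norm (integral {p..q} (\<lambda>t. cis (2 * pi * (y \<bullet> f t))))
      \<le> C * (if u \<bullet> y = 0 then 1 else min (\<bar>u \<bullet> y\<bar> powr (- \<delta>)) 1)"
    using pair_correlation_bound[OF f u, of t\<^sub>0] orth by metis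
  define b where "b n = u \<bullet> w n" for n
  define k where "k n m = (if b n = b m then 1 else min (\<bar>b n - b m\<bar> powr (- \<delta>)) 1)" for n m
  obtain \<epsilon> where \<epsilon>: "0 < \<epsilon>" "\<forall>\<^sub>F N in sequentially. 1 / (real N)\<^sup>2 *
      (\<Sum>n\<in>{1..N}. \<Sum>m\<in>{1..<n}. k n m) \<le> 1 / (ln (real N)) powr (1 + \<epsilon>)"
    using scat pq(3,4) unfolding scattered_def delta_scattered_def k_def b_def by force
  define g where "g n t = cis (2 * pi * (w n \<bullet> f t))" for n t
  have contg: "continuous_on A (g n)" for A n unfolding g_def by (intro continuous_intros real_analytic_continuous_on f)
  have pair: "norm (integral {p..q} (\<lambda>t. g n t * cnj (g m t))) \<le> C * k n m" for n m
  proof -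
    have "g n t * cnj (g m t) = cis (2 * pi * ((w n - w m) \<bullet> f t))" for t
      by (simp add: g_def cis_cnj cis_mult inner_diff_left algebra_simps)
    moreover have eq: "u \<bullet> (w n - w m) = b n - b m" by (simp add: b_def inner_diff_right)
    ultimately show ?thesis using C[of "w n - w m", unfolded eq] by (simp add: k_def)
  qed
  have var: "integral {p..q} (\<lambda>t. (norm ((\<Sum>n\<in>{1..N}. g n t) / N))\<^sup>2)
      \<le> C / (real N)\<^sup>2 * (real N + 2 * (\<Sum>n\<in>{1..N}. \<Sum>m\<in>{1..<n}. k n m))" for N :: nat
  proof -
    define h where "h t = (norm ((\<Sum>n\<in>{1..N}. g n t) / N))\<^sup>2" for t
    have h: "complex_of_real (h t) = (\<Sum>n\<in>{1..N}. \<Sum>m\<in>{1..N}. g n t * cnj (g m t)) * of_real (1 / (real N)\<^sup>2)" for t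
      unfolding h_def complex_norm_square sum_product[symmetric]
      by (simp add: cnj_sum power2_eq_square sum_divide_distrib[symmetric])
    have int: "(\<lambda>t. g n t * cnj (g m t)) integrable_on {p..q}" for n m
      by (intro integrable_continuous_interval continuous_intros contg)
    have "((\<lambda>t. complex_of_real (h t)) has_integral
        (\<Sum>n\<in>{1..N}. \<Sum>m\<in>{1..N}. integral {p..q} (\<lambda>t. g n t * cnj (g m t))) * of_real (1 / (real N)\<^sup>2)) {p..q}"
      unfolding h by (intro has_integral_mult_left has_integral_sum integrable_integral int) auto
    moreover have "h integrable_on {p..q}"
      unfolding h_def by (cases "N = 0") (auto intro!: integrable_continuous_interval continuous_intros contg)
    then have "((\<lambda>t. complex_of_real (h t)) has_integral of_real (integral {p..q} h)) {p..q}"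
      by (intro has_integral_of_real integrable_integral)
    ultimately have "complex_of_real (integral {p..q} h) =
        (\<Sum>n\<in>{1..N}. \<Sum>m\<in>{1..N}. integral {p..q} (\<lambda>t. g n t * cnj (g m t))) * of_real (1 / (real N)\<^sup>2)"
      by (rule has_integral_unique[rotated])
    then have "norm (complex_of_real (integral {p..q} h)) =
        norm (\<Sum>n\<in>{1..N}. \<Sum>m\<in>{1..N}. integral {p..q} (\<lambda>t. g n t * cnj (g m t))) * (1 / (real N)\<^sup>2)"
      by (simp add: norm_mult norm_divide norm_power)
    also have "\<dots> \<le> (\<Sum>n\<in>{1..N}. \<Sum>m\<in>{1..N}. C * k n m) * (1 / (real N)\<^sup>2)"
      by (intro mult_right_mono sum_norm_le pair) auto
    also have "(\<Sum>n\<in>{1..N}. \<Sum>m\<in>{1..N}. C * k n m) = C * (\<Sum>n\<in>{1..N}. \<Sum>m\<in>{1..N}. k n m)"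
      by (simp only: sum_distrib_left)
    also have "(\<Sum>n\<in>{1..N}. \<Sum>m\<in>{1..N}. k n m) = (\<Sum>n\<in>{1..N}. k n n) + 2 * (\<Sum>n\<in>{1..N}. \<Sum>m\<in>{1..<n}. k n m)"
      by (rule sum_square_symmetric) (auto simp: k_def abs_minus_commute)
    also have "(\<Sum>n\<in>{1..N}. k n n) = real N" by (simp add: k_def)
    finally show ?thesis unfolding h_def by (simp add: algebra_simps)
  qed
  \<comment> \<open>The diagonal contributes \<open>1 / N\<close> to the mean square, which the
    logarithmic bound absorbs. In \<open>3 * C\<close> one part is the diagonal and two are the
    symmetric halves.\<close>
  have "\<forall>\<^sub>F N in sequentially. ln (real N) powr (1 + \<epsilon>) \<le> real N" using \<epsilon>(1) by real_asymp
  then have "\<forall>\<^sub>F N in sequentially.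
      integral {p..q} (\<lambda>t. (norm ((\<Sum>n\<in>{1..N}. g n t) / N))\<^sup>2) \<le> (3 * C) / (ln (real N)) powr (1 + \<epsilon>)"
    using \<epsilon>(2) eventually_gt_at_top[of 1]
  proof eventually_elim
    case (elim N)
    define X where "X = (\<Sum>n\<in>{1..N}. \<Sum>m\<in>{1..<n}. k n m)"
    define Y where "Y = 1 / (ln (real N)) powr (1 + \<epsilon>)"
    have "0 < ln (real N) powr (1 + \<epsilon>)" using elim by simp
    then have "1 / real N \<le> Y" unfolding Y_def using elim by (intro divide_left_mono) auto
    moreover have "1 / (real N)\<^sup>2 * X \<le> Y" unfolding X_def Y_def using elim by blast
    ultimately have "1 / real N + 2 * (1 / (real N)\<^sup>2 * X) \<le> 3 * Y" by linarith
    then have "C * (1 / real N + 2 * (1 / (real N)\<^sup>2 * X)) \<le> C * (3 * Y)"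
      using pq(5) by (intro mult_left_mono)
    moreover have "C / (real N)\<^sup>2 * (real N + 2 * X) = C * (1 / real N + 2 * (1 / (real N)\<^sup>2 * X))"
      using elim by (simp add: field_simps power2_eq_square)
    ultimately show ?case using var[of N] unfolding X_def[symmetric] Y_def
      by (simp add: mult.commute[of 3 C])
  qed
  then have "AE t in lborel. t \<in> {p..q} \<longrightarrow> (\<lambda>N. (\<Sum>n\<in>{1..N}. g n t) / N) \<longlonglongrightarrow> 0"
    using pq \<epsilon>(1) by (intro AE_averages_tendsto_0[where C = "3 * C" and \<epsilon> = \<epsilon>] contg) (auto simp: g_def)
  then have "negligible {t. \<not> (t \<in> {p..q} \<longrightarrow> (\<lambda>N. (\<Sum>n\<in>{1..N}. g n t) / N) \<longlonglongrightarrow> 0)}"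
    by (rule AE_imp_negligible)
  then have "negligible (?Bad \<inter> {p<..<q})"
    by (rule negligible_subset) (auto simp: g_def)
  moreover have "openin (top_of_set ?Bad) (?Bad \<inter> {p<..<q})" by (intro openin_open_Int) simp
  moreover have "t\<^sub>0 \<in> ?Bad \<inter> {p<..<q}" using \<open>t\<^sub>0 \<in> ?Bad\<close> pq by auto
  ultimately show "\<exists>U. openin (top_of_set ?Bad) U \<and> t\<^sub>0 \<in> U \<and> negligible U" by blast
qed

text \<open>On a non-degenerate curve only \<open>y = 0\<close> gives a constant, so
  \<open>axis i 1\<close> is admissible and yields the multiple \<open>h i\<close> of
  \<open>a i\<close>. Otherwise the projection \<open>z\<close> of \<open>axis i 1\<close> is
  normalised: it is non-zero as coordinate \<open>i\<close> of \<open>f\<close> is not constant, and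
  \<open>z $ i\<close>, being \<open>z \<bullet> z\<close>, is non-zero too, so a non-trivial
  combination of the sequences arises.\<close>

lemma detecting_direction:
  fixes f :: "real \<Rightarrow> real ^ 'k" and a :: "'k::finite \<Rightarrow> nat \<Rightarrow> real" and h :: "'k \<Rightarrow> int"
  assumes scat: "\<And>i. scattered (a i)" and h: "h i \<noteq> 0"
    and cases: "(jointly_scattered a \<and> no_constant_coordinate (range f)) \<or> nondegenerate (range f)"
  obtains u :: "real ^ 'k" where "norm u = 1" "\<And>y c. (\<And>t. y \<bullet> f t = c) \<Longrightarrow> u \<bullet> y = 0"
    "scattered (\<lambda>n. u \<bullet> (\<chi> j. h j * a j n))"
  using cases
proof (elim disjE conjE)
  assume nd: "nondegenerate (range f)"
  show thesis
  proof (rule that[of "axis i 1"])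
    show "axis i 1 \<bullet> y = 0" if "\<And>t. y \<bullet> f t = c" for y c
      using nd that unfolding nondegenerate_def by (cases "y = 0") auto
    have "1 \<le> \<bar>real_of_int (h i)\<bar>" using h by linarith
    then show "scattered (\<lambda>n. axis i 1 \<bullet> (\<chi> j. h j * a j n))"
      using scattered_mult[OF scat] by (simp add: inner_axis')
  qed simp
next
  assume js: "jointly_scattered a" and nc: "no_constant_coordinate (range f)"
  define V where "V = {y. \<exists>c. \<forall>t. y \<bullet> f t = c}"
  have "subspace V" unfolding V_def subspace_def
    by (auto simp: inner_add_left)
  then have span: "span V = V" by (simp add: span_eq_iff)
  obtain y z where yz: "y \<in> V" "\<And>w. w \<in> V \<Longrightarrow> orthogonal z w" "axis i 1 = y + z"
    using orthogonal_subspace_decomp_exists[of V "axis i 1"] unfolding span by metis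
  have "z \<noteq> 0"
  proof
    assume "z = 0"
    then have "axis i 1 \<in> V" using yz by simp
    then obtain c where "\<And>t. f t $ i = c" unfolding V_def by (auto simp: inner_axis')
    then show False using nc unfolding no_constant_coordinate_def by auto
  qed
  have "z $ i = axis i 1 \<bullet> z" by (simp add: inner_axis')
  also have "\<dots> = z \<bullet> z" using yz(2)[OF yz(1)] unfolding yz(3)
    by (simp add: inner_add_left inner_add_right orthogonal_def inner_commute)
  finally have zi: "z $ i \<noteq> 0" using \<open>z \<noteq> 0\<close> by simp
  show thesis
  proof (rule that[of "z /\<^sub>R norm z"])
    show "norm (z /\<^sub>R norm z) = 1" using \<open>z \<noteq> 0\<close> by simp
    show "(z /\<^sub>R norm z) \<bullet> y = 0" if "\<And>t. y \<bullet> f t = c" for y c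
      using yz(2)[of y] that unfolding V_def orthogonal_def by auto
    define v where "v = (\<chi> j. (z $ j / norm z) * h j)"
    have "v $ i \<noteq> 0" using zi h \<open>z \<noteq> 0\<close> by (simp add: v_def)
    then have "v \<noteq> 0" by auto
    then have "scattered (\<lambda>n. \<Sum>j\<in>UNIV. v $ j * a j n)" using js unfolding jointly_scattered_def by blast
    moreover have "(\<Sum>j\<in>UNIV. v $ j * a j n) = (z /\<^sub>R norm z) \<bullet> (\<chi> j. h j * a j n)" for n
      unfolding v_def inner_vec_def by (intro sum.cong) (auto simp: field_simps)
    ultimately show "scattered (\<lambda>n. (z /\<^sub>R norm z) \<bullet> (\<chi> j. h j * a j n))" by simp
  qed
qed

section \<open>From exceptional parameters to exceptional points of the curve\<close>

theorem theorem1p9: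
  fixes \<gamma> :: "(real ^ 'k) set" and a :: "'k \<Rightarrow> nat \<Rightarrow> real"
  assumes "analytic_curve \<gamma>"
    and "\<And>i. scattered (a i)"
    and "(jointly_scattered a \<and> no_constant_coordinate \<gamma>) \<or> nondegenerate \<gamma>"
  shows "almost_every_on_curve \<gamma> (\<lambda>x. uniformly_distributed_mod1 (\<lambda>n. \<chi> i. a i n * x $ i))"
proof -
  obtain f :: "real \<Rightarrow> real ^ 'k" where f: "real_analytic f" "\<gamma> = range f"
    using assms(1) unfolding analytic_curve_def by blast
  define Bad where "Bad h = {t. \<not> (\<lambda>N. (\<Sum>n\<in>{1..N}. cis (2 * pi * ((\<chi> j. h j * a j n) \<bullet> f t))) / N) \<longlonglongrightarrow> 0}"
    for h :: "'k \<Rightarrow> int"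
  have "negligible (Bad h)" if hi: "h i \<noteq> 0" for h i
  proof -
    show ?thesis
    proof (rule detecting_direction[where f = f and a = a and h = h and i = i, OF assms(2) hi assms(3)[unfolded f(2)]])
      fix u :: "real ^ 'k"
      assume "norm u = 1" "\<And>y c. (\<And>t. y \<bullet> f t = c) \<Longrightarrow> u \<bullet> y = 0"
        "scattered (\<lambda>n. u \<bullet> (\<chi> j. h j * a j n))"
      then show "negligible (Bad h)"
        unfolding Bad_def by (rule exponential_averages_negligible[OF f(1)])
    qed
  qed
  \<comment> \<open>The index type is finite, so there are only countably many integer
    frequencies.\<close>
  then have "negligible (\<Union>h\<in>{h. \<exists>i. h i \<noteq> 0}. Bad h)"
    by (intro negligible_countable_Union) auto
  then have "hausdorff1 (f ` (\<Union>h\<in>{h. \<exists>i. h i \<noteq> 0}. Bad h)) = 0"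
    by (rule hausdorff1_analytic_image_negligible[OF f(1)])
  \<comment> \<open>\<open>f\<close> need not be injective: one preimage of an exceptional point is
    enough, as any preimage is a bad parameter for some frequency.\<close>
  moreover have "{x \<in> \<gamma>. \<not> uniformly_distributed_mod1 (\<lambda>n. \<chi> i. a i n * x $ i)} \<subseteq> f ` (\<Union>h\<in>{h. \<exists>i. h i \<noteq> 0}. Bad h)"
  proof clarify
    fix x assume x: "x \<in> \<gamma>" "\<not> uniformly_distributed_mod1 (\<lambda>n. \<chi> i. a i n * x $ i)"
    then obtain t where t: "x = f t" using f(2) by blast
    have "\<exists>h. (\<exists>i. h i \<noteq> 0) \<and> t \<in> Bad h"
    proof (rule ccontr)
      assume *: "\<not> ?thesis"
      have "uniformly_distributed_mod1 (\<lambda>n. \<chi> i. a i n * x $ i)"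
      proof (rule Weyl_criterion)
        fix h :: "'k \<Rightarrow> int" assume "\<exists>i. h i \<noteq> 0"
        then have "t \<notin> Bad h" using * by blast
        then show "(\<lambda>N. (\<Sum>n\<in>{1..N}. cis (2 * pi * (\<Sum>i\<in>UNIV. h i * (\<chi> i. a i n * x $ i) $ i))) / N) \<longlonglongrightarrow> 0"
          by (simp add: Bad_def inner_vec_def t mult.assoc)
      qed
      then show False using x(2) by contradiction
    qed
    then show "x \<in> f ` (\<Union>h\<in>{h. \<exists>i. h i \<noteq> 0}. Bad h)" using t by blast
  qed
  then have "hausdorff1 {x \<in> \<gamma>. \<not> uniformly_distributed_mod1 (\<lambda>n. \<chi> i. a i n * x $ i)}
      \<le> hausdorff1 (f ` (\<Union>h\<in>{h. \<exists>i. h i \<noteq> 0}. Bad h))" by (rule hausdorff1_mono)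
  ultimately show ?thesis unfolding almost_every_on_curve_def by simp
qed

end
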